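(* Let $A, X \in 2^\omega$ be reals with $X \geq_{tt} A'$. Then there is a real $Y \geq_{tt} A$ such that $X \equiv_{tt} Y' \equiv_{tt} Y \oplus A'$.
   Context: Reals are elements of $2^\omega$. A Turing functional $\Phi$ is a truth-table reduction if there is a computable $f:\omega\to\omega$ such that for every $n$ and every binary string $\sigma$ of length $f(n)$, $\Phi^\sigma(n)$ converges; $A\leq_{tt}B$ means $\Phi(B)=A$ for some truth-table reduction $\Phi$, and $A\equiv_{tt}B$ means reducibility in both directions. $Z'$ denotes the Turing jump of $Z$, and $A\oplus B=\{2n:n\in A\}\cup\{2n+1:n\in B\}$. *)

theory Defs
  imports Main "HOL-Library.Nat_Bijection"
begin

text \<open>Syntax of oracle partial recursive functions. Arguments are lists of naturals.
  The oracle is a partial map nat => nat option; querying an undefined point diverges.\<close>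

datatype recf =
    Zero
  | Succ
  | Proj nat
  | Comp recf "recf list"
  | Prim recf recf
  | Mn recf
  | Orc

inductive eval :: "(nat \<Rightarrow> nat option) \<Rightarrow> recf \<Rightarrow> nat list \<Rightarrow> nat \<Rightarrow> bool" where
  eval_zero: "eval orc Zero xs 0"
| eval_succ: "eval orc Succ (x # xs) (Suc x)"
| eval_proj: "i < length xs \<Longrightarrow> eval orc (Proj i) xs (xs ! i)"
| eval_orc:  "orc x = Some v \<Longrightarrow> eval orc Orc (x # xs) v"
| eval_comp: "length ys = length gs \<Longrightarrow> (\<forall>i < length gs. eval orc (gs ! i) xs (ys ! i))
               \<Longrightarrow> eval orc f ys v \<Longrightarrow> eval orc (Comp f gs) xs v"
| eval_prim0: "eval orc f xs v \<Longrightarrow> eval orc (Prim f g) (0 # xs) v"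
| eval_primS: "eval orc (Prim f g) (n # xs) u \<Longrightarrow> eval orc g (n # u # xs) v
               \<Longrightarrow> eval orc (Prim f g) (Suc n # xs) v"
| eval_mn: "eval orc f (y # xs) 0 \<Longrightarrow> (\<forall>z < y. \<exists>u. eval orc f (z # xs) (Suc u))
               \<Longrightarrow> eval orc (Mn f) xs y"

primrec code :: "recf \<Rightarrow> nat" where
  "code Zero = prod_encode (0, 0)"
| "code Succ = prod_encode (1, 0)"
| "code (Proj i) = prod_encode (2, i)"
| "code (Comp f gs) = prod_encode (3, prod_encode (code f, list_encode (map code gs)))"
| "code (Prim f g) = prod_encode (4, prod_encode (code f, code g))"
| "code (Mn f) = prod_encode (5, code f)"
| "code Orc = prod_encode (6, 0)"

text \<open>Reals (elements of 2^omega) are represented as sets of naturals.\<close>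

definition real_oracle :: "nat set \<Rightarrow> nat \<Rightarrow> nat option" where
  "real_oracle B = (\<lambda>i. Some (if i \<in> B then 1 else 0))"

definition string_oracle :: "bool list \<Rightarrow> nat \<Rightarrow> nat option" where
  "string_oracle \<sigma> = (\<lambda>i. if i < length \<sigma> then Some (if \<sigma> ! i then 1 else 0) else None)"

definition jump :: "nat set \<Rightarrow> nat set" where
  "jump A = {e. \<exists>t v. code t = e \<and> eval (real_oracle A) t [e] v}"

definition join :: "nat set \<Rightarrow> nat set \<Rightarrow> nat set" where
  "join A B = {2 * n | n. n \<in> A} \<union> {2 * n + 1 | n. n \<in> B}"

definition total_computable :: "(nat \<Rightarrow> nat) \<Rightarrow> bool" where
  "total_computable f \<longleftrightarrow> (\<exists>t. \<forall>n. eval (\<lambda>_. None) t [n] (f n))"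

definition tt_functional :: "recf \<Rightarrow> bool" where
  "tt_functional \<Phi> \<longleftrightarrow> (\<exists>f. total_computable f \<and>
      (\<forall>n \<sigma>. length \<sigma> = f n \<longrightarrow> (\<exists>v. eval (string_oracle \<sigma>) \<Phi> [n] v)))"

definition computes_from :: "recf \<Rightarrow> nat set \<Rightarrow> nat set \<Rightarrow> bool" where
  "computes_from \<Phi> B A \<longleftrightarrow> (\<forall>n. eval (real_oracle B) \<Phi> [n] (if n \<in> A then 1 else 0))"

definition tt_le :: "nat set \<Rightarrow> nat set \<Rightarrow> bool" where
  "tt_le A B \<longleftrightarrow> (\<exists>\<Phi>. tt_functional \<Phi> \<and> computes_from \<Phi> B A)"

definition tt_eq :: "nat set \<Rightarrow> nat set \<Rightarrow> bool" where
  "tt_eq A B \<longleftrightarrow> tt_le A B \<and> tt_le B A"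

end

theory Submission
  imports Defs
begin

text \<open>
  Conditions are finite sets \<open>F\<close> of codes; \<open>F\<close> stands for the class of all \<open>G\<close> such that no
  element of \<open>F\<close> lies in the jump of \<open>Y = A \<oplus> G\<close>. By compactness, emptiness of this class is a
  single question to \<open>A'\<close>, so deciding \<open>s \<in> Y'\<close> at stage \<open>s\<close> (add \<open>s\<close> to \<open>F\<close> unless the
  class becomes empty) costs one query. For a tt-reduction of \<open>X\<close> to \<open>Y \<oplus> A'\<close> the
  bit \<open>X(s)\<close> has to be coded into \<open>G\<close> at a computably bounded position, which rules out finite
  extension arguments. Instead \<open>G\<close> is kept in a class of diagonally noncomputable type, itself
  imposed by one code in \<open>F\<close>: for every \<open>F\<close>, if the part \<open>G(F) = b\<close> of the class of \<open>F\<close> is seen to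
  be empty before the part \<open>G(F) = 1 - b\<close>, then \<open>G(F) = b\<close>. Hence a nonempty condition \<open>F\<close> leaves
  both values of \<open>G(F)\<close> possible, and \<open>X(s)\<close> is coded at the position \<open>F\<close>, a code of the
  current condition. All conditions reachable up to stage \<open>s\<close> can be listed computably, so every
  reduction involved has a computable bound on its use.
\<close>

subsection \<open>Computable functions of one argument\<close>

inductive_cases eval_ZeroE: "eval orc Zero xs v"
inductive_cases eval_SuccE: "eval orc Succ xs v"
inductive_cases eval_ProjE: "eval orc (Proj i) xs v"
inductive_cases eval_OrcE: "eval orc Orc xs v"
inductive_cases eval_CompE: "eval orc (Comp f gs) xs v"
inductive_cases eval_Prim0E: "eval orc (Prim f g) (0 # xs) v"
inductive_cases eval_PrimSE: "eval orc (Prim f g) (Suc n # xs) v"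
inductive_cases eval_MnE: "eval orc (Mn f) xs v"

lemma eval_det:
  "eval orc t xs v \<Longrightarrow> eval orc t xs w \<Longrightarrow> v = w"
proof (induction arbitrary: w rule: eval.induct)
  case (eval_zero orc xs)
  then show ?case
    by (auto elim: eval_ZeroE)
next
  case (eval_succ orc x xs)
  then show ?case
    by (auto elim: eval_SuccE)
next
  case (eval_proj i xs orc)
  then show ?case
    by (auto elim: eval_ProjE)
next
  case (eval_orc orc x v xs)
  then show ?case
    by (auto elim: eval_OrcE)
next
  case (eval_prim0 orc f xs v g)
  then show ?case
    by (blast elim: eval_Prim0E)
next
  case (eval_comp ys gs orc xs f v)
  from eval_comp.prems obtain zs where zs: "length zs = length gs"
    "\<forall>i<length gs. eval orc (gs ! i) xs (zs ! i)" "eval orc f zs w"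
    by (auto elim: eval_CompE)
  have "ys = zs"
    using eval_comp.hyps(1) zs(1,2) eval_comp.IH(1) by (intro nth_equalityI) (simp, metis)
  then show ?case
    using eval_comp.IH zs by blast
next
  case (eval_primS orc f g n xs u v)
  from eval_primS.prems obtain u' where "eval orc (Prim f g) (n # xs) u'"
    "eval orc g (n # u' # xs) w"
    by (auto elim: eval_PrimSE)
  then show ?case
    using eval_primS.IH by blast
next
  case (eval_mn orc f y xs)
  from eval_mn.prems have w: "eval orc f (w # xs) 0" "\<forall>z<w. \<exists>u. eval orc f (z # xs) (Suc u)"
    by (auto elim: eval_MnE)
  show ?case
  proof (cases y w rule: linorder_cases)
    case less
    then obtain u where "eval orc f (y # xs) (Suc u)"
      using w by blast
    then show ?thesis
      using eval_mn.IH(1) by blast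
  next
    case greater
    then show ?thesis
      using eval_mn.IH(2) w(1) by blast
  qed simp
qed

text \<open>A converging computation has only asked queries that were answered, so further answers
  do not change it. This carries computations from the empty oracle to every oracle and from a
  string to its extensions.\<close>

lemma eval_mono:
  assumes "eval orc t xs v" "\<And>i u. orc i = Some u \<Longrightarrow> orc' i = Some u"
  shows "eval orc' t xs v"
  using assms
proof (induction rule: eval.induct)
  case (eval_mn orc f y xs)
  then show ?case
    by (intro eval.eval_mn) blast+
qed (auto intro: eval.intros)

lemma eval_Comp1:
  "eval orc g xs y \<Longrightarrow> eval orc f [y] v \<Longrightarrow> eval orc (Comp f [g]) xs v"
  by (rule eval_comp[of "[y]"]) auto

lemma eval_Comp2:
  "eval orc g xs y \<Longrightarrow> eval orc h xs z \<Longrightarrow> eval orc f [y, z] v \<Longrightarrow> eval orc (Comp f [g, h]) xs v"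
  by (rule eval_comp[of "[y, z]"]) (auto simp: less_Suc_eq)

text \<open>Determinism gives the forward direction, so divergence is transported as well as
  convergence.\<close>

lemma eval_Comp1_iff:
  "eval orc g xs y \<Longrightarrow> eval orc (Comp f [g]) xs v \<longleftrightarrow> eval orc f [y] v"
proof
  assume y: "eval orc g xs y" and "eval orc (Comp f [g]) xs v"
  then obtain ys where "length ys = 1" "eval orc g xs (ys ! 0)" "eval orc f ys v"
    by (auto elim: eval_CompE)
  moreover from this have "ys = [y]"
    using eval_det[OF y] by (cases ys) auto
  ultimately show "eval orc f [y] v"
    by simp
qed (rule eval_Comp1)

lemma eval_Proj: "i < length xs \<Longrightarrow> y = xs ! i \<Longrightarrow> eval orc (Proj i) xs y"
  by (simp add: eval_proj)

lemma eval_Prim: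
  assumes "eval orc f xs (r 0)" "\<And>n. n < k \<Longrightarrow> eval orc g (n # r n # xs) (r (Suc n))"
  shows "eval orc (Prim f g) (k # xs) (r k)"
  using assms(2)
proof (induction k)
  case 0
  then show ?case
    using assms(1) by (auto intro: eval_prim0)
next
  case (Suc k)
  then show ?case
    by (auto intro: eval_primS)
qed

text \<open>By \<open>eval_mono\<close> the term that computes \<open>f\<close> without an oracle
  does so with any oracle, so computable functions can be plugged into oracle computations.\<close>

lemma total_computable_iff:
  "total_computable f \<longleftrightarrow> (\<exists>t. \<forall>orc x. eval orc t [x] (f x))"
  unfolding total_computable_def by (metis eval_mono option.distinct(1))

definition binary_computable :: "(nat \<Rightarrow> nat \<Rightarrow> nat) \<Rightarrow> bool" where
  "binary_computable f \<longleftrightarrow> (\<exists>t. \<forall>orc x y. eval orc t [x, y] (f x y))"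

text \<open>The rules collected here are stated for composed functions and predicates of one
  argument, so that \<open>intro computable\<close> decomposes an expression along its
  structure.\<close>

named_theorems computable

lemma computable_compose:
  assumes "total_computable f" "total_computable g"
  shows "total_computable (\<lambda>x. f (g x))"
  using assms unfolding total_computable_iff by (meson eval_Comp1)

lemma computable_compose2:
  assumes "binary_computable f" "total_computable g" "total_computable h"
  shows "total_computable (\<lambda>x. f (g x) (h x))"
  using assms unfolding total_computable_iff binary_computable_def by (meson eval_Comp2)

lemma binary_computable_compose:
  assumes "total_computable f" "binary_computable g"
  shows "binary_computable (\<lambda>x y. f (g x y))"
  using assms unfolding total_computable_iff binary_computable_def by (meson eval_Comp1)

lemma binary_computable_compose2:
  assumes "binary_computable f" "binary_computable g" "binary_computable h"
  shows "binary_computable (\<lambda>x y. f (g x y) (h x y))"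
  using assms unfolding binary_computable_def by (meson eval_Comp2)

lemma binary_computable_fst: "binary_computable (\<lambda>x y. x)"
  unfolding binary_computable_def by (intro exI[of _ "Proj 0"]) (auto intro: eval_Proj)

lemma binary_computable_snd: "binary_computable (\<lambda>x y. y)"
  unfolding binary_computable_def by (intro exI[of _ "Proj 1"]) (auto intro: eval_Proj)

lemma computable_id [computable]: "total_computable (\<lambda>x. x)"
  unfolding total_computable_iff by (intro exI[of _ "Proj 0"]) (auto intro: eval_Proj)

lemma computable_Suc0: "total_computable Suc"
  unfolding total_computable_iff by (intro exI[of _ Succ]) (auto intro: eval_succ)

lemmas computable_Suc [computable] = computable_compose[OF computable_Suc0]

lemma computable_const [computable]: "total_computable (\<lambda>x. c)"
proof (induction c)
  case 0
  then show ?case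
    unfolding total_computable_iff by (intro exI[of _ Zero]) (auto intro: eval_zero)
next
  case (Suc c)
  then show ?case
    by (rule computable_Suc)
qed

lemma computable_unary_rec:
  assumes "binary_computable g" "r 0 = c" "\<And>n. r (Suc n) = g n (r n)"
  shows "total_computable r"
proof -
  obtain s where s: "\<And>orc x. eval orc s [x] c"
    using computable_const[of c] unfolding total_computable_iff by blast
  obtain t where t: "\<And>orc x y. eval orc t [x, y] (g x y)"
    using assms(1) unfolding binary_computable_def by blast
  have "eval orc (Prim (Comp s [Zero]) t) [n] (r n)" for orc n
    using s t assms(2,3) by (intro eval_Prim) (auto intro: eval_Comp1 eval_zero)
  then show ?thesis
    unfolding total_computable_iff by blast
qed

lemma binary_computable_rec:
  assumes "total_computable f" "binary_computable g" "\<And>x. r 0 x = f x" "\<And>n x. r (Suc n) x = g (r n x) x"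
  shows "binary_computable r"
proof -
  obtain s where s: "\<And>orc x. eval orc s [x] (f x)"
    using assms(1) unfolding total_computable_iff by blast
  obtain t where t: "\<And>orc x y. eval orc t [x, y] (g x y)"
    using assms(2) unfolding binary_computable_def by blast
  have "eval orc (Prim s (Comp t [Proj 1, Proj 2])) [n, x] (r n x)" for orc n x
    using s t assms(3,4)
    by (intro eval_Prim[where r = "\<lambda>n. r n x"]) (auto intro!: eval_Comp2 intro: eval_Proj)
  then show ?thesis
    unfolding binary_computable_def by blast
qed

lemma binary_computable_add: "binary_computable (+)"
  by (rule binary_computable_rec[OF computable_id
        binary_computable_compose[OF computable_Suc0 binary_computable_fst]]) auto

lemma binary_computable_diff: "binary_computable (-)"
proof -
  have pred: "total_computable (\<lambda>x. x - 1)"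
    by (rule computable_unary_rec[where c = 0 and g = "\<lambda>n u. n"]) (auto intro: binary_computable_fst)
  have "binary_computable (\<lambda>n x. x - n)"
    by (rule binary_computable_rec[OF computable_id
          binary_computable_compose[OF pred binary_computable_fst]]) auto
  from binary_computable_compose2[OF this binary_computable_snd binary_computable_fst]
  show ?thesis .
qed

lemma computable_triangle: "total_computable triangle"
  by (rule computable_unary_rec[where c = 0 and g = "\<lambda>n u. u + Suc n"])
    (auto intro!: binary_computable_compose2[OF binary_computable_add] binary_computable_compose[OF computable_Suc0]
       binary_computable_fst binary_computable_snd)

lemma binary_computable_pair: "binary_computable (\<lambda>x y. prod_encode (x, y))"
  unfolding prod_encode_def split_conv
  by (intro binary_computable_compose2[OF binary_computable_add] binary_computable_compose[OF computable_triangle]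
       binary_computable_fst binary_computable_snd)

lemmas computable_add [computable] = computable_compose2[OF binary_computable_add]
lemmas computable_diff [computable] = computable_compose2[OF binary_computable_diff]
lemmas computable_pair [computable] = computable_compose2[OF binary_computable_pair]

section \<open>Computable inverse of the pairing function\<close>

abbreviation pfst :: "nat \<Rightarrow> nat" where "pfst z \<equiv> fst (prod_decode z)"
abbreviation psnd :: "nat \<Rightarrow> nat" where "psnd z \<equiv> snd (prod_decode z)"

text \<open>The root of \<open>z\<close> is the largest \<open>r\<close> with
  \<open>triangle r \<le> z\<close>. With truncated subtraction the increment is \<open>1\<close>
  exactly when \<open>Suc z\<close> has reached the next triangular number.\<close>

primrec triangle_root :: "nat \<Rightarrow> nat" where
  "triangle_root 0 = 0"
| "triangle_root (Suc z) =
     triangle_root z + (1 - (triangle (Suc (triangle_root z)) - Suc z))"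

lemma triangle_root:
  "triangle (triangle_root z) \<le> z \<and> z < triangle (Suc (triangle_root z))"
proof (induction z)
  case (Suc z)
  show ?case
  proof (cases "triangle (Suc (triangle_root z)) \<le> Suc z")
    case True
    then have "triangle_root (Suc z) = Suc (triangle_root z)"
      by simp
    then show ?thesis
      using True Suc by simp
  next
    case False
    then have "triangle_root (Suc z) = triangle_root z"
      by simp
    then show ?thesis
      using False Suc by simp
  qed
qed simp

text \<open>As \<open>prod_encode (m, n)\<close> is \<open>triangle (m + n) + m\<close>, the root
  recovers \<open>m + n\<close> and the remainder is \<open>m\<close>.\<close>

lemma prod_decode_triangle_root:
  "prod_decode z = (z - triangle (triangle_root z), triangle_root z - (z - triangle (triangle_root z)))"
proof -
  have "prod_encode (z - triangle (triangle_root z), triangle_root z - (z - triangle (triangle_root z))) = z"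
    using triangle_root[of z] by (auto simp: prod_encode_def)
  then show ?thesis
    by (metis prod_encode_inverse)
qed

lemma computable_triangle_root: "total_computable triangle_root"
  by (rule computable_unary_rec[where c = 0 and g = "\<lambda>z u. u + (1 - (triangle (Suc u) - Suc z))"])
    (auto intro!: binary_computable_compose2[OF binary_computable_add] binary_computable_compose[OF computable_Suc0]
       binary_computable_compose2[OF binary_computable_diff] binary_computable_compose[OF computable_triangle]
       binary_computable_compose[OF computable_const binary_computable_fst]
       binary_computable_fst binary_computable_snd)

lemma computable_pfst [computable]: "total_computable f \<Longrightarrow> total_computable (\<lambda>x. pfst (f x))"
  unfolding prod_decode_triangle_root fst_conv
  by (intro computable computable_compose[OF computable_triangle] computable_compose[OF computable_triangle_root])

lemma computable_psnd [computable]: "total_computable f \<Longrightarrow> total_computable (\<lambda>x. psnd (f x))"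
  unfolding prod_decode_triangle_root snd_conv
  by (intro computable computable_compose[OF computable_triangle] computable_compose[OF computable_triangle_root])

lemma computable_binary:
  assumes "total_computable (\<lambda>z. f (pfst z) (psnd z))"
  shows "binary_computable f"
  using binary_computable_compose[OF assms binary_computable_pair] by simp

text \<open>Parameter, step number and previous value are packed into one number \<open>z\<close>,
  so the premise on \<open>h\<close> is again about a function of one argument. The rules for sums,
  searches and bounded quantifiers treat their bound variables in the same way.\<close>

lemma computable_rec_nat [computable]:
  assumes "total_computable g" "total_computable (\<lambda>z. h (pfst z) (pfst (psnd z)) (psnd (psnd z)))"
    "total_computable b"
  shows "total_computable (\<lambda>x. rec_nat (g x) (h x) (b x))"
proof -
  obtain s where s: "\<And>orc x. eval orc s [x] (g x)"
    using assms(1) unfolding total_computable_iff by blast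
  obtain t where t: "\<And>orc z. eval orc t [z] (h (pfst z) (pfst (psnd z)) (psnd (psnd z)))"
    using assms(2) unfolding total_computable_iff by blast
  obtain p where p: "\<And>orc x y. eval orc p [x, y] (prod_encode (x, y))"
    using binary_computable_pair unfolding binary_computable_def by blast
  \<comment> \<open>\<open>Prim\<close> supplies the arguments in the order \<open>n, u, x\<close>;
    the projections rearrange them into the nested pair that \<open>t\<close> expects.\<close>
  have t': "eval orc (Comp t [Comp p [Proj 2, Comp p [Proj 0, Proj 1]]]) [n, u, x] (h x n u)"
    for orc n u x
    using t[of orc "prod_encode (x, prod_encode (n, u))"]
    by (auto intro!: eval_Comp1 eval_Comp2 intro: p eval_Proj)
  have "eval orc (Prim s (Comp t [Comp p [Proj 2, Comp p [Proj 0, Proj 1]]])) [n, x]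
      (rec_nat (g x) (h x) n)" for orc n x
    using s t' by (intro eval_Prim) auto
  then have "binary_computable (\<lambda>n x. rec_nat (g x) (h x) n)"
    unfolding binary_computable_def by blast
  from computable_compose2[OF this assms(3) computable_id] show ?thesis .
qed

lemma computable_Least:
  assumes "total_computable (\<lambda>z. f (pfst z) (psnd z))" "\<And>x. \<exists>y. f x y = 0"
  shows "total_computable (\<lambda>x. LEAST y. f x y = 0)"
proof -
  have "binary_computable (\<lambda>y x. f x y)"
    by (intro binary_computable_compose2[OF computable_binary[OF assms(1)]] binary_computable_fst binary_computable_snd)
  then obtain t where t: "\<And>orc y x. eval orc t [y, x] (f x y)"
    unfolding binary_computable_def by blast
  have "eval orc (Mn t) [x] (LEAST y. f x y = 0)" for orc x
  proof (intro eval_mn allI impI)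
    show "eval orc t [LEAST y. f x y = 0, x] 0"
      using t[of orc "LEAST y. f x y = 0" x] LeastI_ex[OF assms(2)[of x]] by simp
    fix z assume "z < (LEAST y. f x y = 0)"
    then have "f x z \<noteq> 0"
      using not_less_Least by blast
    then show "\<exists>u. eval orc t [z, x] (Suc u)"
      using t[of orc z x] by (metis not0_implies_Suc)
  qed
  then show ?thesis
    unfolding total_computable_iff by blast
qed

subsection \<open>Decidable predicates and coded sets and lists\<close>

definition decidable :: "(nat \<Rightarrow> bool) \<Rightarrow> bool" where
  "decidable P \<longleftrightarrow> total_computable (\<lambda>x. of_bool (P x))"

lemma computable_mult [computable]:
  assumes "total_computable f" "total_computable g"
  shows "total_computable (\<lambda>x. f x * g x)"
proof -
  have "total_computable (\<lambda>x. rec_nat 0 (\<lambda>_ u. u + f x) (g x))"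
    by (intro computable assms computable_compose[OF assms(1)])
  moreover have "rec_nat 0 (\<lambda>_ u. u + m) n = m * n" for m n :: nat
    by (induction n) auto
  ultimately show ?thesis
    by simp
qed

lemma computable_power [computable]:
  assumes "total_computable f" "total_computable g"
  shows "total_computable (\<lambda>x. f x ^ g x)"
proof -
  have "total_computable (\<lambda>x. rec_nat 1 (\<lambda>_ u. u * f x) (g x))"
    by (intro computable assms computable_compose[OF assms(1)])
  moreover have "rec_nat 1 (\<lambda>_ u. u * m) n = m ^ n" for m n :: nat
    by (induction n) auto
  ultimately show ?thesis
    by simp
qed

lemma computable_sum [computable]:
  assumes "total_computable b" "total_computable (\<lambda>z. f (pfst z) (psnd z))"
  shows "total_computable (\<lambda>x. \<Sum>i<b x. f x i)"
proof -
  have "total_computable (\<lambda>z. f (pfst z) (pfst (psnd z)))"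
    using computable_compose[OF assms(2), of "\<lambda>z. prod_encode (pfst z, pfst (psnd z))"]
      computable_pair[OF computable_pfst[OF computable_id] computable_pfst[OF computable_psnd[OF computable_id]]]
    by simp
  then have "total_computable (\<lambda>x. rec_nat 0 (\<lambda>i u. u + f x i) (b x))"
    by (intro computable assms)
  moreover have "rec_nat 0 (\<lambda>i u. u + f x i) n = (\<Sum>i<n. f x i)" for x n
    by (induction n) auto
  ultimately show ?thesis
    by simp
qed

lemma decidable_eq_0 [computable]: "total_computable f \<Longrightarrow> decidable (\<lambda>x. f x = 0)"
proof -
  assume "total_computable f"
  then have "total_computable (\<lambda>x. 1 - f x)"
    by (intro computable)
  moreover have "(\<lambda>x. 1 - f x) = (\<lambda>x. of_bool (f x = 0))"
    by auto
  ultimately show ?thesis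
    unfolding decidable_def by simp
qed

lemma decidable_compose:
  "decidable P \<Longrightarrow> total_computable f \<Longrightarrow> decidable (\<lambda>x. P (f x))"
  unfolding decidable_def by (rule computable_compose)

lemma computable_of_bool [computable]: "decidable P \<Longrightarrow> total_computable (\<lambda>x. of_bool (P x))"
  unfolding decidable_def .

lemma decidable_const [computable]: "decidable (\<lambda>x. p)"
  unfolding decidable_def by (rule computable_const)

lemma decidable_not [computable]: "decidable P \<Longrightarrow> decidable (\<lambda>x. \<not> P x)"
  using decidable_eq_0[OF computable_of_bool, of P] by simp

lemma decidable_conj [computable]:
  "decidable P \<Longrightarrow> decidable Q \<Longrightarrow> decidable (\<lambda>x. P x \<and> Q x)"
  using decidable_not[OF decidable_eq_0[OF computable_mult[OF computable_of_bool[of P] computable_of_bool[of Q]]]] by simp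

lemma decidable_disj [computable]:
  "decidable P \<Longrightarrow> decidable Q \<Longrightarrow> decidable (\<lambda>x. P x \<or> Q x)"
  using decidable_not[OF decidable_conj[OF decidable_not[of P] decidable_not[of Q]]] by simp

lemma decidable_imp [computable]:
  "decidable P \<Longrightarrow> decidable Q \<Longrightarrow> decidable (\<lambda>x. P x \<longrightarrow> Q x)"
  using decidable_disj[OF decidable_not[of P], of Q] by simp

lemma decidable_iff [computable]:
  "decidable P \<Longrightarrow> decidable Q \<Longrightarrow> decidable (\<lambda>x. P x \<longleftrightarrow> Q x)"
  using decidable_conj[OF decidable_imp[of P Q] decidable_imp[of Q P]] by (simp flip: iff_conv_conj_imp)

lemma decidable_le [computable]:
  "total_computable f \<Longrightarrow> total_computable g \<Longrightarrow> decidable (\<lambda>x. f x \<le> g x)"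
  using decidable_eq_0[OF computable_diff, of f g] by simp

lemma decidable_less [computable]:
  "total_computable f \<Longrightarrow> total_computable g \<Longrightarrow> decidable (\<lambda>x. f x < g x)"
  using decidable_not[OF decidable_le, of g f] by (simp add: not_le)

lemma decidable_eq [computable]:
  "total_computable f \<Longrightarrow> total_computable g \<Longrightarrow> decidable (\<lambda>x. f x = g x)"
  using decidable_conj[OF decidable_le[of f g] decidable_le[of g f]] by (simp flip: order.eq_iff)

lemma decidable_Ex [computable]:
  assumes "total_computable b" "decidable (\<lambda>z. P (pfst z) (psnd z))"
  shows "decidable (\<lambda>x. \<exists>i<b x. P x i)"
proof -
  have "decidable (\<lambda>x. (\<Sum>i<b x. of_bool (P x i)) \<noteq> (0::nat))"
    using assms by (intro computable)
  then show ?thesis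
    by (simp add: disjoint_iff)
qed

lemma decidable_All [computable]:
  assumes "total_computable b" "decidable (\<lambda>z. P (pfst z) (psnd z))"
  shows "decidable (\<lambda>x. \<forall>i<b x. P x i)"
proof -
  have "decidable (\<lambda>x. \<not> (\<exists>i<b x. \<not> P x i))"
    using assms by (intro computable)
  then show ?thesis
    by simp
qed

lemma computable_if [computable]:
  assumes "decidable P" "total_computable f" "total_computable g"
  shows "total_computable (\<lambda>x. if P x then f x else g x)"
proof -
  have "total_computable (\<lambda>x. of_bool (P x) * f x + of_bool (\<not> P x) * g x)"
    using assms by (intro computable)
  moreover have "(\<lambda>x. of_bool (P x) * f x + of_bool (\<not> P x) * g x) =
      (\<lambda>x. if P x then f x else g x)"
    by auto
  ultimately show ?thesis
    by simp
qed

lemma computable_LEAST: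
  assumes "decidable (\<lambda>z. P (pfst z) (psnd z))" "\<And>x. \<exists>y. P x y"
  shows "total_computable (\<lambda>x. LEAST y. P x y)"
  using computable_Least[of "\<lambda>x y. of_bool (\<not> P x y)"]
    computable_of_bool[OF decidable_not[OF assms(1)]] assms(2) by simp

lemma computable_div2 [computable]:
  assumes "total_computable f"
  shows "total_computable (\<lambda>x. f x div 2)"
proof -
  \<comment> \<open>Half of \<open>m\<close>, rounded down, is the least \<open>y\<close> with
    \<open>m < 2 * y + 2\<close>, which turns division into a search that always succeeds.\<close>
  have "total_computable (\<lambda>x. LEAST y. f x < 2 * y + 2)"
  proof (rule computable_LEAST)
    show "decidable (\<lambda>z. f (pfst z) < 2 * psnd z + 2)"
      by (intro computable computable_compose[OF assms])
    show "\<exists>y. f x < 2 * y + 2" for x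
      by (rule exI[of _ "f x"]) simp
  qed
  moreover have "(LEAST y. n < 2 * y + 2) = n div 2" for n :: nat
    by (intro Least_equality) auto
  ultimately show ?thesis
    by simp
qed

lemma decidable_even [computable]:
  assumes "total_computable f"
  shows "decidable (\<lambda>x. even (f x))"
proof -
  have "decidable (\<lambda>x. f x = 2 * (f x div 2))"
    using assms by (intro computable)
  moreover have "n = 2 * (n div 2) \<longleftrightarrow> even n" for n :: nat
    by presburger
  ultimately show ?thesis
    by simp
qed

section \<open>Uniformly computable families of sets and codes of finite sets\<close>

definition computable_set :: "(nat \<Rightarrow> nat set) \<Rightarrow> bool" where
  "computable_set B \<longleftrightarrow> decidable (\<lambda>z. psnd z \<in> B (pfst z))"

lemma computable_set_compose:
  assumes "computable_set B" "total_computable f"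
  shows "computable_set (\<lambda>x. B (f x))"
proof -
  have "total_computable (\<lambda>z. prod_encode (f (pfst z), psnd z))"
    using assms by (intro computable computable_compose[OF assms(2)])
  from decidable_compose[OF assms(1)[unfolded computable_set_def] this] show ?thesis
    by (simp add: computable_set_def)
qed

lemma decidable_mem [computable]:
  assumes "total_computable f" "computable_set B"
  shows "decidable (\<lambda>x. f x \<in> B x)"
proof -
  have "total_computable (\<lambda>x. prod_encode (x, f x))"
    using assms by (intro computable)
  from decidable_compose[OF assms(2)[unfolded computable_set_def] this] show ?thesis
    by simp
qed

lemma computable_set_decode [computable]:
  assumes "total_computable f"
  shows "computable_set (\<lambda>x. set_decode (f x))"
proof -
  \<comment> \<open>Halving \<open>n\<close> times shifts bit \<open>n\<close> to the units
    position, where parity reads it.\<close>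
  have "rec_nat m (\<lambda>_ u. u div 2) n = m div 2 ^ n" for m n :: nat
    by (induction n) (simp_all flip: div_mult2_eq, simp add: mult.commute)
  then have "set_decode m = {n. odd (rec_nat m (\<lambda>_ u. u div 2) n)}" for m
    by (simp add: set_decode_def)
  moreover have "decidable (\<lambda>z. odd (rec_nat (f (pfst z)) (\<lambda>_ u. u div 2) (psnd z)))"
    by (intro computable computable_compose[OF assms])
  ultimately show ?thesis
    unfolding computable_set_def by simp
qed

lemma mem_join: "n \<in> join A B \<longleftrightarrow> (if even n then n div 2 \<in> A else n div 2 \<in> B)"
  unfolding join_def by (auto elim!: evenE oddE) presburger+

lemma double_mem_join [simp]: "2 * n \<in> join A B \<longleftrightarrow> n \<in> A" "Suc (2 * n) \<in> join A B \<longleftrightarrow> n \<in> B"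
  by (auto simp: mem_join)

lemma computable_set_join [computable]:
  assumes "computable_set A" "computable_set B"
  shows "computable_set (\<lambda>x. join (A x) (B x))"
proof -
  have "decidable (\<lambda>z. (even (psnd z) \<longrightarrow> psnd z div 2 \<in> A (pfst z)) \<and> (odd (psnd z) \<longrightarrow> psnd z div 2 \<in> B (pfst z)))"
    using assms by (intro computable computable_set_compose[OF assms(1)] computable_set_compose[OF assms(2)])
  then show ?thesis
    unfolding computable_set_def by (simp add: mem_join if_bool_eq_conj)
qed

lemma computable_set_Collect [computable]:
  assumes "decidable (\<lambda>z. P (pfst z) (psnd z))"
  shows "computable_set (\<lambda>x. {y. P x y})"
  using assms by (simp add: computable_set_def)

text \<open>A set bit \<open>n\<close> needs \<open>2 ^ n \<le> m\<close>. The bound makes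
  quantifiers over a coded set bounded and therefore decidable.\<close>

lemma mem_set_decode_less: "n \<in> set_decode m \<Longrightarrow> n < m"
proof -
  assume "n \<in> set_decode m"
  then have "2 ^ n \<le> m"
    unfolding set_decode_def by (metis div_less even_zero mem_Collect_eq not_le)
  then show ?thesis
    using less_exp[of n] by linarith
qed

lemma decidable_Ball_set_decode [computable]:
  assumes "total_computable m" "decidable (\<lambda>z. P (pfst z) (psnd z))"
  shows "decidable (\<lambda>x. \<forall>i\<in>set_decode (m x). P x i)"
proof -
  have "decidable (\<lambda>x. \<forall>i<m x. i \<in> set_decode (m x) \<longrightarrow> P x i)"
    using assms by (intro computable computable_compose[OF assms(1)])
  moreover have "(\<forall>i<k. i \<in> set_decode k \<longrightarrow> P x i) \<longleftrightarrow> (\<forall>i\<in>set_decode k. P x i)" for k x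
    using mem_set_decode_less by blast
  ultimately show ?thesis
    by simp
qed

lemma decidable_Bex_set_decode [computable]:
  assumes "total_computable m" "decidable (\<lambda>z. P (pfst z) (psnd z))"
  shows "decidable (\<lambda>x. \<exists>i\<in>set_decode (m x). P x i)"
  using decidable_not[OF decidable_Ball_set_decode[OF assms(1) decidable_not[OF assms(2)]]] by simp

definition ins :: "nat \<Rightarrow> nat \<Rightarrow> nat" where
  "ins x F = set_encode (insert x (set_decode F))"

lemma set_decode_ins [simp]: "set_decode (ins x F) = insert x (set_decode F)"
  by (simp add: ins_def finite_set_decode)

lemma computable_ins [computable]:
  assumes "total_computable f" "total_computable g"
  shows "total_computable (\<lambda>x. ins (f x) (g x))"
proof -
  have "ins x F = (if x \<in> set_decode F then F else F + 2 ^ x)" for x F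
    by (auto simp: ins_def insert_absorb set_encode_insert finite_set_decode)
  then have ins_eq: "(\<lambda>x. ins (f x) (g x)) =
      (\<lambda>x. if f x \<in> set_decode (g x) then g x else g x + 2 ^ f x)"
    by (intro ext)
  show ?thesis
    unfolding ins_eq by (intro computable assms)
qed

section \<open>Codes of lists\<close>

abbreviation cons_code :: "nat \<Rightarrow> nat \<Rightarrow> nat" where "cons_code x xs \<equiv> Suc (prod_encode (x, xs))"
abbreviation hd_code :: "nat \<Rightarrow> nat" where "hd_code z \<equiv> pfst (z - 1)"
abbreviation tl_code :: "nat \<Rightarrow> nat" where "tl_code z \<equiv> psnd (z - 1)"

text \<open>A nonempty list is coded by the successor of a pair. As \<open>prod_decode 0\<close> is
  \<open>(0, 0)\<close>, the code \<open>0\<close> of the empty list is its own tail, so dropping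
  past the end stays at \<open>0\<close>.\<close>

definition drop_code :: "nat \<Rightarrow> nat \<Rightarrow> nat" where
  "drop_code i z = rec_nat z (\<lambda>_ u. tl_code u) i"

definition length_code :: "nat \<Rightarrow> nat" where
  "length_code z = (LEAST i. drop_code i z = 0)"

definition nth_code :: "nat \<Rightarrow> nat \<Rightarrow> nat" where
  "nth_code z i = hd_code (drop_code i z)"

lemma prod_decode_0: "prod_decode 0 = (0, 0)"
  by (simp add: prod_decode_triangle_root)

lemma drop_code_list_encode: "drop_code i (list_encode xs) = list_encode (drop i xs)"
proof (induction i)
  case (Suc i)
  have "tl_code (list_encode ys) = list_encode (tl ys)" for ys
    by (cases ys) (simp_all add: prod_decode_0)
  then have "drop_code (Suc i) (list_encode xs) = list_encode (tl (drop i xs))"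
    using Suc by (simp add: drop_code_def)
  then show ?case
    by (simp add: drop_Suc tl_drop)
qed (simp add: drop_code_def)

lemma list_encode_eq_0_iff: "list_encode xs = 0 \<longleftrightarrow> xs = []"
  by (cases xs) auto

lemma length_code_list_encode [simp]: "length_code (list_encode xs) = length xs"
  unfolding length_code_def drop_code_list_encode list_encode_eq_0_iff
  by (intro Least_equality) auto

lemma nth_code_list_encode [simp]: "i < length xs \<Longrightarrow> nth_code (list_encode xs) i = xs ! i"
  unfolding nth_code_def drop_code_list_encode by (simp add: Cons_nth_drop_Suc[symmetric])

lemma computable_drop_code [computable]:
  "total_computable f \<Longrightarrow> total_computable g \<Longrightarrow> total_computable (\<lambda>x. drop_code (f x) (g x))"
  unfolding drop_code_def by (intro computable)

lemma computable_nth_code [computable]: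
  "total_computable f \<Longrightarrow> total_computable g \<Longrightarrow> total_computable (\<lambda>x. nth_code (f x) (g x))"
  unfolding nth_code_def by (intro computable)

lemma computable_length_code [computable]:
  assumes "total_computable f"
  shows "total_computable (\<lambda>x. length_code (f x))"
proof -
  have "\<exists>i. drop_code i z = 0" for z
    using drop_code_list_encode[of "length (list_decode z)" "list_decode z"] by auto
  then show ?thesis
    unfolding length_code_def
    by (intro computable_LEAST computable computable_compose[OF assms])
qed

subsection \<open>Coded derivations\<close>

abbreviation triple :: "nat \<Rightarrow> nat \<Rightarrow> nat \<Rightarrow> nat" where
  "triple c x v \<equiv> prod_encode (c, prod_encode (x, v))"

text \<open>Derivations alone do not certify that a number is a code: the term \<open>g\<close> in
  \<open>Prim f g\<close> is never evaluated if the recursion argument is \<open>0\<close>. Hence \<open>V\<close>.\<close>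

definition code_step :: "nat set \<Rightarrow> nat \<Rightarrow> nat \<Rightarrow> bool" where
  "code_step V k y \<longleftrightarrow>
     (k = 0 \<or> k = 1 \<or> k = 6) \<and> y = 0 \<or> k = 2
   \<or> k = 3 \<and> pfst y \<in> V \<and> (\<forall>i<length_code (psnd y). nth_code (psnd y) i \<in> V)
   \<or> k = 4 \<and> pfst y \<in> V \<and> psnd y \<in> V
   \<or> k = 5 \<and> y \<in> V"

definition codes_closed :: "nat set \<Rightarrow> bool" where
  "codes_closed V \<longleftrightarrow> (\<forall>c\<in>V. code_step V (pfst c) (psnd c))"

text \<open>One application of a rule of \<open>eval\<close> with oracle \<open>B\<close> and
  premises taken from \<open>D\<close>: \<open>k\<close> is the constructor tag, \<open>y\<close>
  the rest of the code, \<open>x\<close> the coded argument list and \<open>v\<close> the value.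
  \<open>V\<close> certifies the code of the step term of a primitive recursion.\<close>

definition eval_step :: "nat set \<Rightarrow> nat set \<Rightarrow> nat set \<Rightarrow> nat \<Rightarrow> nat \<Rightarrow> nat \<Rightarrow> nat \<Rightarrow> bool" where
  "eval_step B V D k y x v \<longleftrightarrow>
     k = 0 \<and> y = 0 \<and> v = 0
   \<or> k = 1 \<and> y = 0 \<and> x \<noteq> 0 \<and> v = Suc (hd_code x)
   \<or> k = 2 \<and> y < length_code x \<and> v = nth_code x y
   \<or> k = 3 \<and> (\<exists>ys. triple (pfst y) ys v \<in> D \<and> length_code ys = length_code (psnd y) \<and>
       (\<forall>i<length_code ys. triple (nth_code (psnd y) i) x (nth_code ys i) \<in> D))
   \<or> k = 4 \<and> psnd y \<in> V \<and> x \<noteq> 0 \<and> hd_code x = 0 \<and> triple (pfst y) (tl_code x) v \<in> D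
   \<or> k = 4 \<and> psnd y \<in> V \<and> x \<noteq> 0 \<and> hd_code x \<noteq> 0 \<and>
       (\<exists>u. triple (prod_encode (k, y)) (cons_code (hd_code x - 1) (tl_code x)) u \<in> D \<and>
         triple (psnd y) (cons_code (hd_code x - 1) (cons_code u (tl_code x))) v \<in> D)
   \<or> k = 5 \<and> triple y (cons_code v x) 0 \<in> D \<and> (\<forall>z<v. \<exists>u. triple y (cons_code z x) (Suc u) \<in> D)
   \<or> k = 6 \<and> y = 0 \<and> x \<noteq> 0 \<and> v = of_bool (hd_code x \<in> B)"

definition derivation :: "nat set \<Rightarrow> nat set \<Rightarrow> nat set \<Rightarrow> bool" where
  "derivation B V D \<longleftrightarrow> codes_closed V \<and>
     (\<forall>w\<in>D. eval_step B V D (pfst (pfst w)) (psnd (pfst w)) (pfst (psnd w)) (psnd (psnd w)))"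

lemma code_step_mono: "code_step V k y \<Longrightarrow> V \<subseteq> V' \<Longrightarrow> code_step V' k y"
  unfolding code_step_def by blast

text \<open>\<open>V\<close> and \<open>D\<close> occur only positively. Hence unions of derivations
  are derivations.\<close>

lemma eval_step_mono:
  "eval_step B V D k y x v \<Longrightarrow> V \<subseteq> V' \<Longrightarrow> D \<subseteq> D' \<Longrightarrow> eval_step B V' D' k y x v"
  unfolding eval_step_def by (elim disj_forward conj_forward ex_forward) (auto 0 4)

text \<open>This descent drives the inductions on codes: the constructors with subterms have the
  tags 3 to 5, which are positive.\<close>

lemma less_prod_encode: "0 < k \<Longrightarrow> y < prod_encode (k, y)"
proof -
  assume "0 < k"
  moreover have "n \<le> triangle n" for n
    by (induction n) auto
  from this[of "k + y"] have "k + y \<le> triangle (k + y)" .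
  ultimately show ?thesis
    by (simp add: prod_encode_def)
qed

lemma member_le_list_encode: "x \<in> set xs \<Longrightarrow> x \<le> list_encode xs"
proof (induction xs)
  case (Cons y ys)
  then show ?case
    using le_prod_encode_1[of y "list_encode ys"] le_prod_encode_2[of "list_encode ys" y] by auto
qed simp

lemma pfst_le: "pfst z \<le> z" and psnd_le: "psnd z \<le> z"
  using le_prod_encode_1[of "pfst z" "psnd z"] le_prod_encode_2[of "psnd z" "pfst z"] by simp_all

text \<open>Strong induction on \<open>c\<close>: the numbers that \<open>code_step\<close> requires
  in \<open>V\<close> are at most \<open>y\<close>, and \<open>y\<close> lies below \<open>c\<close>
  because the tag is positive in these cases.\<close>

lemma codes_closed_code:
  assumes "codes_closed V" "c \<in> V"
  shows "\<exists>t. code t = c"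
  using assms(2)
proof (induction c rule: less_induct)
  case (less c)
  define k y where "k = pfst c" and "y = psnd c"
  have c: "c = prod_encode (k, y)"
    by (simp add: k_def y_def)
  have "code_step V k y"
    using assms(1) less.prems unfolding codes_closed_def k_def y_def by blast
  moreover have IH: "\<exists>t. code t = c'" if "c' \<in> V" "c' \<le> y" "0 < k" for c'
    using less.IH less_prod_encode[of k y] that c by auto
  ultimately consider "k = 0 \<or> k = 1 \<or> k = 6" "y = 0" | "k = 2"
    | "k = 3" "pfst y \<in> V" "\<forall>i<length_code (psnd y). nth_code (psnd y) i \<in> V"
    | "k = 4" "pfst y \<in> V" "psnd y \<in> V" | "k = 5" "y \<in> V"
    unfolding code_step_def by blast
  then show ?case
  proof cases
    case 1
    then show ?thesis
      unfolding c using code.simps(1,2,7) by blast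
  next
    case 2
    then show ?thesis
      unfolding c using code.simps(3) by blast
  next
    case 3
    define cs where "cs = list_decode (psnd y)"
    have cs: "psnd y = list_encode cs"
      by (simp add: cs_def)
    have "\<exists>t. code t = d" if "d \<in> set cs" for d
    proof (rule IH)
      from that obtain i where "i < length cs" "d = cs ! i"
        by (metis in_set_conv_nth)
      then show "d \<in> V"
        using 3(3) by (simp add: cs)
      show "d \<le> y"
        using that psnd_le[of y] member_le_list_encode[of d cs] cs by linarith
    qed (simp add: 3)
    then obtain ts where ts: "cs = map code ts"
      by (metis ex_map_conv)
    obtain f where "code f = pfst y"
      using IH[of "pfst y"] 3 pfst_le by auto
    then have "code (Comp f ts) = c"
      using ts by (simp add: c 3(1) flip: ts cs)
    then show ?thesis
      by blast
  next
    case 4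
    obtain f g where "code f = pfst y" "code g = psnd y"
      using IH[of "pfst y"] IH[of "psnd y"] 4 pfst_le psnd_le by fastforce
    then have "code (Prim f g) = c"
      by (simp add: c 4(1))
    then show ?thesis
      by blast
  next
    case 5
    obtain f where "code f = y"
      using IH[of y] 5 by auto
    then have "code (Mn f) = c"
      by (simp add: c 5(1))
    then show ?thesis
      by blast
  qed
qed

lemma codes_closed_Un: "codes_closed V \<Longrightarrow> codes_closed V' \<Longrightarrow> codes_closed (V \<union> V')"
  unfolding codes_closed_def by (auto intro: code_step_mono)

lemma codes_closed_UN: "(\<And>i. i \<in> I \<Longrightarrow> codes_closed (V i)) \<Longrightarrow> codes_closed (\<Union>i\<in>I. V i)"
  unfolding codes_closed_def by (auto intro: code_step_mono)

lemma codes_closed_insert: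
  "codes_closed V \<Longrightarrow> code_step V k y \<Longrightarrow> codes_closed (insert (prod_encode (k, y)) V)"
  unfolding codes_closed_def by (auto intro: code_step_mono)

text \<open>Induction on \<open>t\<close>: unite the closed sets of the immediate subterms and add
  the code of \<open>t\<close> itself.\<close>

lemma codes_closed_exists: "\<exists>V. finite V \<and> codes_closed V \<and> code t \<in> V"
proof (induction t)
  case (Comp f gs)
  then obtain V where V: "finite V" "codes_closed V" "code f \<in> V"
    by blast
  from Comp have "\<forall>g\<in>set gs. \<exists>V. finite V \<and> codes_closed V \<and> code g \<in> V"
    by blast
  then obtain W where W: "\<And>g. g \<in> set gs \<Longrightarrow> finite (W g) \<and> codes_closed (W g) \<and> code g \<in> W g"
    by metis
  let ?V = "V \<union> (\<Union>g\<in>set gs. W g)"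
  have "codes_closed ?V"
    using V W by (intro codes_closed_Un codes_closed_UN) auto
  moreover have "code_step ?V 3 (prod_encode (code f, list_encode (map code gs)))"
    using V(3) W nth_mem[of _ gs] unfolding code_step_def by fastforce
  ultimately have "codes_closed (insert (code (Comp f gs)) ?V)"
    unfolding code.simps by (rule codes_closed_insert)
  then show ?case
    using V W by (intro exI[of _ "insert (code (Comp f gs)) ?V"]) auto
next
  case (Prim f g)
  then obtain V W where V: "finite V" "codes_closed V" "code f \<in> V"
    and W: "finite W" "codes_closed W" "code g \<in> W"
    by blast
  have "codes_closed (insert (code (Prim f g)) (V \<union> W))"
    unfolding code.simps using V W
    by (intro codes_closed_insert codes_closed_Un) (auto simp: code_step_def)
  then show ?case
    using V W by (intro exI[of _ "insert (code (Prim f g)) (V \<union> W)"]) auto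
next
  case (Mn f)
  then obtain V where V: "finite V" "codes_closed V" "code f \<in> V"
    by blast
  have "codes_closed (insert (code (Mn f)) V)"
    unfolding code.simps using V by (intro codes_closed_insert) (auto simp: code_step_def)
  then show ?case
    using V by (intro exI[of _ "insert (code (Mn f)) V"]) auto
next
  case Zero
  show ?case
    by (rule exI[of _ "{code Zero}"]) (simp add: codes_closed_def code_step_def)
next
  case Succ
  show ?case
    by (rule exI[of _ "{code Succ}"]) (simp add: codes_closed_def code_step_def)
next
  case (Proj i)
  show ?case
    by (rule exI[of _ "{code (Proj i)}"]) (simp add: codes_closed_def code_step_def)
next
  case Orc
  show ?case
    by (rule exI[of _ "{code Orc}"]) (simp add: codes_closed_def code_step_def)
qed

text \<open>Soundness produces a term for each member of a derivation separately; injectivity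
  identifies the terms found for equal codes.\<close>

lemma code_inject: "code s = code t \<Longrightarrow> s = t"
proof (induction s arbitrary: t)
  case (Comp f gs)
  then obtain f' gs' where t: "t = Comp f' gs'" "code f = code f'" "map code gs = map code gs'"
    by (cases t) (auto simp: list_encode_eq)
  have "gs = gs'"
    using t(3) Comp.IH(2) by (intro nth_equalityI) (metis length_map, metis length_map nth_map nth_mem)
  then show ?case
    using t Comp.IH(1) by auto
next
  case (Prim f g)
  then show ?case
    by (cases t) auto
next
  case (Mn f)
  then show ?case
    by (cases t) auto
qed (case_tac t; simp)+

lemma list_decode_nonzero: "x \<noteq> 0 \<Longrightarrow> list_decode x = hd_code x # list_decode (tl_code x)"
  by (cases x) (auto split: prod.split)

lemma length_code: "length_code x = length (list_decode x)"
  by (metis length_code_list_encode list_decode_inverse)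

lemma nth_code: "i < length_code x \<Longrightarrow> nth_code x i = list_decode x ! i"
  by (metis length_code_list_encode list_decode_inverse nth_code_list_encode)

text \<open>No order on the derivation is needed: the premises of a step concern a smaller code, or
  the same code of a primitive recursion with a smaller recursion argument.\<close>

lemma derivation_sound:
  assumes "derivation B V D" "triple c x v \<in> D"
  shows "\<exists>t. code t = c \<and> eval (real_oracle B) t (list_decode x) v"
  using assms(2)
proof (induction c arbitrary: x v rule: less_induct)
  case (less c)
  define k y where "k = pfst c" and "y = psnd c"
  have c: "c = prod_encode (k, y)"
    by (simp add: k_def y_def)
  have step: "eval_step B V D k y x v" if "triple c x v \<in> D" for x v
    using assms(1) that unfolding derivation_def k_def y_def by fastforce
  have V: "codes_closed V"
    using assms(1) unfolding derivation_def by blast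
  have IH: "\<exists>t. code t = c' \<and> eval (real_oracle B) t (list_decode x) v"
    if "triple c' x v \<in> D" "c' \<le> y" "0 < k" for c' x v
    using less.IH less_prod_encode[of k y] that c by auto
  consider "k = 0" "y = 0" "v = 0" | "k = 1" "y = 0" "x \<noteq> 0" "v = Suc (hd_code x)"
    | "k = 2" "y < length_code x" "v = nth_code x y"
    | ys where "k = 3" "triple (pfst y) ys v \<in> D" "length_code ys = length_code (psnd y)"
        "\<forall>i<length_code ys. triple (nth_code (psnd y) i) x (nth_code ys i) \<in> D"
    | "k = 4" | "k = 5" "triple y (cons_code v x) 0 \<in> D" "\<forall>z<v. \<exists>u. triple y (cons_code z x) (Suc u) \<in> D"
    | "k = 6" "y = 0" "x \<noteq> 0" "v = of_bool (hd_code x \<in> B)"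
    using step[OF less.prems] unfolding eval_step_def by blast
  then show ?case
  proof cases
    case 1
    then show ?thesis
      unfolding c by (intro exI[of _ Zero]) (auto intro: eval_zero)
  next
    case 2
    then show ?thesis
      unfolding c by (intro exI[of _ Succ]) (auto simp: list_decode_nonzero[of x] intro: eval_succ)
  next
    case 3
    then show ?thesis
      unfolding c by (intro exI[of _ "Proj y"]) (auto simp: nth_code length_code intro: eval_proj)
  next
    case (4 ys)
    define cs where "cs = list_decode (psnd y)"
    define us where "us = list_decode ys"
    have cs: "psnd y = list_encode cs" and us: "ys = list_encode us"
      by (simp_all add: cs_def us_def)
    have len: "length us = length cs"
      using 4(3) unfolding cs us by simp
    have "\<exists>t. code t = cs ! i \<and> eval (real_oracle B) t (list_decode x) (us ! i)" if "i < length cs" for i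
    proof (rule IH)
      show "triple (cs ! i) x (us ! i) \<in> D"
        using 4(4) that len unfolding cs us by auto
      show "cs ! i \<le> y"
        using that psnd_le[of y] member_le_list_encode[of "cs ! i" cs] cs by simp
    qed (simp add: 4)
    then obtain T where T: "\<And>i. i < length cs \<Longrightarrow>
        code (T i) = cs ! i \<and> eval (real_oracle B) (T i) (list_decode x) (us ! i)"
      by metis
    define ts where "ts = map T [0..<length cs]"
    have ts: "map code ts = cs" "\<forall>i<length ts. eval (real_oracle B) (ts ! i) (list_decode x) (us ! i)"
      using T by (auto simp: ts_def intro!: nth_equalityI)
    obtain f where f: "code f = pfst y" "eval (real_oracle B) f us v"
      using IH[OF 4(2)] 4(1) pfst_le by (auto simp: us_def)
    have "eval (real_oracle B) (Comp f ts) (list_decode x) v"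
      using ts f len by (intro eval_comp[of us]) (auto simp: ts_def)
    moreover have "code (Comp f ts) = c"
      using f by (simp add: c 4(1) ts flip: cs)
    ultimately show ?thesis
      by blast
  next
    case 5
    \<comment> \<open>The step term comes from \<open>V\<close>, since a recursion that stops at
      \<open>0\<close> never evaluates it.\<close>
    obtain g where g: "code g = psnd y"
      using step[OF less.prems] codes_closed_code[OF V] 5 unfolding eval_step_def by auto
    \<comment> \<open>The code stays the same along a primitive recursion, so the recursive premise
      is handled by an inner induction on the recursion argument \<open>n\<close>.\<close>
    have "\<exists>f. code f = pfst y \<and> eval (real_oracle B) (Prim f g) (n # list_decode z) v"
      if "triple c (cons_code n z) v \<in> D" for n z v
      using that
    proof (induction n arbitrary: v)
      case 0
      then have "triple (pfst y) z v \<in> D"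
        using step[of "cons_code 0 z" v] 5 unfolding eval_step_def by auto
      from IH[OF this] show ?case
        using pfst_le 5 eval_prim0 by fastforce
    next
      case (Suc n)
      then obtain u where u: "triple c (cons_code n z) u \<in> D"
          "triple (psnd y) (cons_code n (cons_code u z)) v \<in> D"
        using step[of "cons_code (Suc n) z" v] 5 c unfolding eval_step_def by auto
      obtain f where f: "code f = pfst y" "eval (real_oracle B) (Prim f g) (n # list_decode z) u"
        using Suc.IH u(1) by blast
      obtain g' where g': "code g' = psnd y" "eval (real_oracle B) g' (n # u # list_decode z) v"
        using IH[OF u(2)] psnd_le 5 by auto
      have "g' = g"
        using g g'(1) by (simp add: code_inject)
      then have "eval (real_oracle B) g (n # u # list_decode z) v"
        using g'(2) by simp
      then show ?case
        using f eval_primS by blast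
    qed
    moreover have "x \<noteq> 0"
      using step[OF less.prems] 5 unfolding eval_step_def by auto
    then have x: "x = cons_code (hd_code x) (tl_code x)"
      by simp
    ultimately obtain f where f: "code f = pfst y"
        "eval (real_oracle B) (Prim f g) (hd_code x # list_decode (tl_code x)) v"
      using less.prems by metis
    then show ?thesis
      using list_decode_nonzero[OF \<open>x \<noteq> 0\<close>] g 5 c by (intro exI[of _ "Prim f g"]) simp
  next
    case 6
    obtain f where f: "code f = y" "eval (real_oracle B) f (v # list_decode x) 0"
      using IH[OF 6(2)] 6(1) by auto
    have "\<exists>u. eval (real_oracle B) f (z # list_decode x) (Suc u)" if "z < v" for z
    proof -
      from 6(3) that obtain u where "triple y (cons_code z x) (Suc u) \<in> D"
        by blast
      from IH[OF this] obtain f' where f': "code f' = y"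
          "eval (real_oracle B) f' (z # list_decode x) (Suc u)"
        using 6(1) by auto
      have "f' = f"
        using f(1) f'(1) by (simp add: code_inject)
      then show ?thesis
        using f'(2) by blast
    qed
    then have "eval (real_oracle B) (Mn f) (list_decode x) v"
      using f by (intro eval_mn) auto
    then show ?thesis
      using f 6(1) c by (intro exI[of _ "Mn f"]) auto
  next
    case 7
    then show ?thesis
      unfolding c by (intro exI[of _ Orc])
        (auto simp: list_decode_nonzero[of x] real_oracle_def intro!: eval_orc)
  qed
qed

section \<open>Completeness of finite derivations\<close>

lemma derivation_UN:
  "(\<And>i. i \<in> I \<Longrightarrow> derivation B (V i) (D i)) \<Longrightarrow> derivation B (\<Union>i\<in>I. V i) (\<Union>i\<in>I. D i)"
  unfolding derivation_def
  by (intro conjI codes_closed_UN) (blast, blast intro: eval_step_mono)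

lemma derivation_weaken_codes:
  "derivation B V D \<Longrightarrow> codes_closed W \<Longrightarrow> derivation B (V \<union> W) D"
  unfolding derivation_def by (blast intro: codes_closed_Un eval_step_mono)

lemma derivation_insert:
  "derivation B V D \<Longrightarrow> eval_step B V D k y x v \<Longrightarrow>
    derivation B V (insert (triple (prod_encode (k, y)) x v) D)"
  unfolding derivation_def by (auto intro: eval_step_mono)

definition derivable :: "nat set \<Rightarrow> nat \<Rightarrow> nat \<Rightarrow> nat \<Rightarrow> bool" where
  "derivable B c x v \<longleftrightarrow> (\<exists>V D. finite V \<and> finite D \<and> derivation B V D \<and> triple c x v \<in> D)"

text \<open>\<open>I\<close> indexes the premises of a rule. The union of their derivations is
  enlarged by the closed set \<open>W\<close> of codes and then by the conclusion.\<close>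

lemma derivable_step:
  assumes "finite I" "\<And>i. i \<in> I \<Longrightarrow> derivable B (c i) (x i) (v i)" "finite W" "codes_closed W"
    "\<And>V D. W \<subseteq> V \<Longrightarrow> (\<And>i. i \<in> I \<Longrightarrow> triple (c i) (x i) (v i) \<in> D) \<Longrightarrow> eval_step B V D k y x' v'"
  shows "derivable B (prod_encode (k, y)) x' v'"
proof -
  from assms(2) obtain V D where VD: "\<And>i. i \<in> I \<Longrightarrow>
      finite (V i) \<and> finite (D i) \<and> derivation B (V i) (D i) \<and> triple (c i) (x i) (v i) \<in> D i"
    unfolding derivable_def by metis
  have "derivation B ((\<Union>i\<in>I. V i) \<union> W) (\<Union>i\<in>I. D i)"
    using VD assms(4) by (intro derivation_weaken_codes derivation_UN) auto
  moreover have "eval_step B ((\<Union>i\<in>I. V i) \<union> W) (\<Union>i\<in>I. D i) k y x' v'"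
    using VD by (intro assms(5)) auto
  ultimately have "derivation B ((\<Union>i\<in>I. V i) \<union> W) (insert (triple (prod_encode (k, y)) x' v') (\<Union>i\<in>I. D i))"
    by (rule derivation_insert)
  then show ?thesis
    using VD assms(1,3) unfolding derivable_def by (metis finite_UN finite_Un finite_insert insertI1)
qed

lemma codes_closed_empty: "codes_closed {}"
  by (simp add: codes_closed_def)

lemmas derivable_axiom =
  derivable_step[where I = "{}" and W = "{}", simplified, OF codes_closed_empty]

lemma derivation_complete:
  assumes "eval (real_oracle B) t xs v"
  shows "derivable B (code t) (list_encode xs) v"
  using assms
proof (induction "real_oracle B" t xs v rule: eval.induct)
  case (eval_zero xs)
  then show ?case
    unfolding code.simps by (intro derivable_axiom) (simp add: eval_step_def)
next
  case (eval_succ x xs)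
  then show ?case
    unfolding code.simps by (intro derivable_axiom) (simp add: eval_step_def)
next
  case (eval_proj i xs)
  then show ?case
    unfolding code.simps by (intro derivable_axiom) (simp add: eval_step_def)
next
  case (eval_orc x v xs)
  then show ?case
    unfolding code.simps by (intro derivable_axiom) (auto simp: eval_step_def real_oracle_def)
next
  case (eval_comp ys gs xs f v)
  let ?n = "length gs"
  show ?case
    unfolding code.simps
  \<comment> \<open>An index \<open>i < ?n\<close> stands for the inner call of
    \<open>gs ! i\<close>, the index \<open>?n\<close> for the outer call of
    \<open>f\<close>.\<close>
  proof (rule derivable_step[where I = "{..?n}" and W = "{}"
        and c = "\<lambda>i. if i < ?n then code (gs ! i) else code f"
        and x = "\<lambda>i. if i < ?n then list_encode xs else list_encode ys"
        and v = "\<lambda>i. if i < ?n then ys ! i else v"])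
    fix V D
    assume D: "\<And>i. i \<in> {..?n} \<Longrightarrow> triple (if i < ?n then code (gs ! i) else code f)
      (if i < ?n then list_encode xs else list_encode ys) (if i < ?n then ys ! i else v) \<in> D"
    have "triple (code f) (list_encode ys) v \<in> D"
      using D[of ?n] by simp
    moreover have "triple (code (gs ! i)) (list_encode xs) (ys ! i) \<in> D" if "i < ?n" for i
      using D[of i] that by simp
    ultimately show "eval_step B V D 3 (prod_encode (code f, list_encode (map code gs))) (list_encode xs) v"
      unfolding eval_step_def using eval_comp.hyps(1) by (auto intro!: exI[of _ "list_encode ys"])
  qed (use eval_comp.hyps in \<open>auto simp: codes_closed_empty\<close>)
next
  case (eval_prim0 f xs v g)
  obtain W where W: "finite W" "codes_closed W" "code g \<in> W"
    using codes_closed_exists by blast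
  show ?case
    unfolding code.simps
    by (rule derivable_step[where I = "{()}" and W = W and c = "\<lambda>_. code f"
          and x = "\<lambda>_. list_encode xs" and v = "\<lambda>_. v"])
      (use eval_prim0.hyps W in \<open>auto simp: eval_step_def\<close>)
next
  case (eval_primS f g n xs u v)
  obtain W where W: "finite W" "codes_closed W" "code g \<in> W"
    using codes_closed_exists by blast
  show ?case
    unfolding code.simps
  \<comment> \<open>\<open>True\<close> indexes the call of \<open>g\<close>, \<open>False\<close>
    the recursive call on \<open>n\<close>.\<close>
  proof (rule derivable_step[where I = UNIV and W = W
        and c = "\<lambda>b. if b then code g else code (Prim f g)"
        and x = "\<lambda>b. if b then list_encode (n # u # xs) else list_encode (n # xs)"
        and v = "\<lambda>b. if b then v else u"])
    fix V D
    assume V: "W \<subseteq> V" and D: "\<And>b. b \<in> UNIV \<Longrightarrow> triple (if b then code g else code (Prim f g))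
      (if b then list_encode (n # u # xs) else list_encode (n # xs)) (if b then v else u) \<in> D"
    show "eval_step B V D 4 (prod_encode (code f, code g)) (list_encode (Suc n # xs)) v"
      unfolding eval_step_def using V W D[of True] D[of False] by auto
  qed (use eval_primS.hyps W in auto)
next
  case (eval_mn f y xs)
  from eval_mn.hyps(3) obtain U where U: "\<And>z. z < y \<Longrightarrow> derivable B (code f) (list_encode (z # xs)) (Suc (U z))"
    by metis
  show ?case
    unfolding code.simps
  \<comment> \<open>An index \<open>z < y\<close> stands for the positive value at \<open>z\<close>,
    the index \<open>y\<close> for the zero.\<close>
  proof (rule derivable_step[where I = "{..y}" and W = "{}" and c = "\<lambda>_. code f"
        and x = "\<lambda>z. list_encode (z # xs)" and v = "\<lambda>z. if z < y then Suc (U z) else 0"])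
    fix V D
    assume D: "\<And>z. z \<in> {..y} \<Longrightarrow>
      triple (code f) (list_encode (z # xs)) (if z < y then Suc (U z) else 0) \<in> D"
    have "triple (code f) (list_encode (y # xs)) 0 \<in> D"
      using D[of y] by simp
    moreover have "triple (code f) (list_encode (z # xs)) (Suc (U z)) \<in> D" if "z < y" for z
      using D[of z] that by simp
    ultimately show "eval_step B V D 5 (code f) (list_encode xs) y"
      unfolding eval_step_def by auto
  qed (use eval_mn.hyps U in \<open>auto simp: codes_closed_empty\<close>)
qed

text \<open>The one number \<open>l\<close> bounds the codes of \<open>V\<close> and
  \<open>D\<close> and the value. This makes the predicate decidable and monotone in
  \<open>l\<close>, and it bounds the oracle queries as well. \<open>cons_code e 0\<close> is the
  code of the list \<open>[e]\<close>.\<close>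

definition halts_within :: "nat \<Rightarrow> nat \<Rightarrow> nat set \<Rightarrow> bool" where
  "halts_within l e B \<longleftrightarrow> (\<exists>V<l. \<exists>D<l. \<exists>v<l. derivation B (set_decode V) (set_decode D) \<and>
     triple e (cons_code e 0) v \<in> set_decode D)"

lemma halts_within_mono: "halts_within l e B \<Longrightarrow> l \<le> l' \<Longrightarrow> halts_within l' e B"
  unfolding halts_within_def by (meson order_less_le_trans)

lemma jump_iff_halts_within: "e \<in> jump B \<longleftrightarrow> (\<exists>l. halts_within l e B)"
proof
  assume "e \<in> jump B"
  then obtain t v where t: "code t = e" "eval (real_oracle B) t [e] v"
    unfolding jump_def by blast
  from derivation_complete[OF t(2)] obtain V D where "finite V" "finite D" "derivation B V D"
    "triple e (cons_code e 0) v \<in> D"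
    unfolding derivable_def t(1) by auto
  then have "halts_within (Suc (set_encode V + set_encode D + v)) e B"
    unfolding halts_within_def
    by (intro exI[of _ "set_encode V"] conjI exI[of _ "set_encode D"] exI[of _ v]) auto
  then show "\<exists>l. halts_within l e B" ..
next
  assume "\<exists>l. halts_within l e B"
  then obtain V D v where "derivation B V D" "triple e (cons_code e 0) v \<in> D"
    unfolding halts_within_def by blast
  from derivation_sound[OF this] show "e \<in> jump B"
    unfolding jump_def by auto
qed

lemma hd_code_le: "hd_code x \<le> x"
  using pfst_le[of "x - 1"] by linarith

text \<open>Every query is a component of a member of \<open>D\<close>, hence smaller than the code
  of \<open>D\<close> and than \<open>l\<close>.\<close>

lemma halts_within_local:
  assumes "halts_within l e B" "B \<inter> {..<l} = B' \<inter> {..<l}"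
  shows "halts_within l e B'"
proof -
  from assms(1) obtain V D v where bounds: "V < l" "D < l" "v < l"
    and D: "derivation B (set_decode V) (set_decode D)" "triple e (cons_code e 0) v \<in> set_decode D"
    unfolding halts_within_def by blast
  have "hd_code (pfst (psnd w)) \<in> B \<longleftrightarrow> hd_code (pfst (psnd w)) \<in> B'" if "w \<in> set_decode D" for w
  proof -
    have "hd_code (pfst (psnd w)) < l"
      using mem_set_decode_less[OF that] hd_code_le[of "pfst (psnd w)"] pfst_le[of "psnd w"]
        psnd_le[of w] bounds(2) by linarith
    then show ?thesis
      using assms(2) by blast
  qed
  then have "derivation B' (set_decode V) (set_decode D)"
    using D(1) unfolding derivation_def eval_step_def by (simp cong: ball_cong)
  then show ?thesis
    unfolding halts_within_def using bounds D(2) by blast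
qed

section \<open>Decidability of bounded halting\<close>

lemma decidable_code_step [computable]:
  assumes "total_computable V" "total_computable k" "total_computable y"
  shows "decidable (\<lambda>x. code_step (set_decode (V x)) (k x) (y x))"
  unfolding code_step_def by (intro computable assms computable_compose[OF assms(1)] computable_compose[OF assms(3)])

lemma decidable_codes_closed [computable]:
  assumes "total_computable V"
  shows "decidable (\<lambda>x. codes_closed (set_decode (V x)))"
  unfolding codes_closed_def by (intro computable assms computable_compose[OF assms(1)])

lemma triple_mem_set_decode_less:
  assumes "triple c x v \<in> set_decode D"
  shows "x < D" "v < D"
proof -
  have "x \<le> triple c x v" "v \<le> triple c x v"
    using le_prod_encode_1 le_prod_encode_2 le_trans by blast+
  then show "x < D" "v < D"
    using mem_set_decode_less[OF assms] by linarith+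
qed

lemma decidable_eval_step [computable]:
  assumes "computable_set B" "total_computable V" "total_computable D" "total_computable k"
    "total_computable y" "total_computable x" "total_computable v"
  shows "decidable (\<lambda>z. eval_step (B z) (set_decode (V z)) (set_decode (D z)) (k z) (y z) (x z) (v z))"
proof -
  \<comment> \<open>Each witness sits inside a triple that belongs to \<open>D\<close>, so the code
    of \<open>D\<close> bounds it and the quantifiers become bounded.\<close>
  have bound: "(\<exists>ys. triple c ys v \<in> set_decode D \<and> P ys) \<longleftrightarrow> (\<exists>ys<D. triple c ys v \<in> set_decode D \<and> P ys)"
      "(\<exists>u. triple c x u \<in> set_decode D \<and> P u) \<longleftrightarrow> (\<exists>u<D. triple c x u \<in> set_decode D \<and> P u)"
      "(\<exists>u. triple c x (Suc u) \<in> set_decode D) \<longleftrightarrow> (\<exists>u<D. triple c x (Suc u) \<in> set_decode D)"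
    for c x v P D
    using triple_mem_set_decode_less by (blast, blast, meson Suc_lessD)
  show ?thesis
    unfolding eval_step_def bound
    by (intro computable assms assms(2-)[THEN computable_compose])
qed

lemma decidable_derivation [computable]:
  assumes "computable_set B" "total_computable V" "total_computable D"
  shows "decidable (\<lambda>z. derivation (B z) (set_decode (V z)) (set_decode (D z)))"
  unfolding derivation_def
  by (intro computable assms assms(2,3)[THEN computable_compose] computable_set_compose[OF assms(1)])

lemma decidable_halts_within [computable]:
  assumes "total_computable l" "total_computable e" "computable_set B"
  shows "decidable (\<lambda>z. halts_within (l z) (e z) (B z))"
  unfolding halts_within_def
  by (intro computable assms assms(1,2)[THEN computable_compose] computable_set_compose[OF assms(3)])

subsection \<open>Truth-table reductions\<close>

text \<open>A primitive recursion on \<open>l\<close> adds \<open>2 ^ n\<close> whenever the oracle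
  answers \<open>1\<close> at \<open>n\<close>. Only the first \<open>l\<close> answers are used, so
  the same term serves reals and finite strings.\<close>

lemma oracle_prefix_term:
  "\<exists>t. \<forall>orc B l. (\<forall>i<l. orc i = Some (of_bool (i \<in> B))) \<longrightarrow> eval orc t [l] (set_encode (B \<inter> {..<l}))"
proof -
  obtain a where a: "\<And>orc x y. eval orc a [x, y] (x + y)"
    using binary_computable_add unfolding binary_computable_def by blast
  have "total_computable (\<lambda>z. 2 ^ pfst z * psnd z)"
    by (intro computable)
  then obtain h where h: "\<And>orc x y. eval orc h [x, y] (2 ^ x * y)"
    using computable_binary[of "\<lambda>x y. 2 ^ x * y"] unfolding binary_computable_def by blast
  define g where "g = Comp a [Proj 1, Comp h [Proj 0, Comp Orc [Proj 0]]]"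
  have "eval orc (Prim Zero g) [l] (set_encode (B \<inter> {..<l}))"
    if orc: "\<forall>i<l. orc i = Some (of_bool (i \<in> B))" for orc B l
  proof (rule eval_Prim[where r = "\<lambda>l. set_encode (B \<inter> {..<l})"])
    show "eval orc Zero [] (set_encode (B \<inter> {..<0}))"
      using eval_zero by simp
    fix n assume n: "n < l"
    have "set_encode (B \<inter> {..<Suc n}) = set_encode (B \<inter> {..<n}) + 2 ^ n * of_bool (n \<in> B)"
      by (auto simp: lessThan_Suc set_encode_insert)
    moreover have "eval orc g [n, set_encode (B \<inter> {..<n})] (set_encode (B \<inter> {..<n}) + 2 ^ n * of_bool (n \<in> B))"
      unfolding g_def using orc n
      by (intro eval_Comp2[OF _ _ a] eval_Comp2[OF _ _ h] eval_Comp1[OF _ eval_orc]) (auto intro: eval_Proj)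
    ultimately show "eval orc g [n, set_encode (B \<inter> {..<n})] (set_encode (B \<inter> {..<Suc n}))"
      by simp
  qed
  then show ?thesis
    by blast
qed

section \<open>Jump indices of searches, uniform in a parameter\<close>

primrec const_term :: "nat \<Rightarrow> recf" where
  "const_term 0 = Zero"
| "const_term (Suc n) = Comp Succ [const_term n]"

lemma eval_const_term: "eval orc (const_term n) xs n"
  by (induction n) (auto intro: eval_zero eval_Comp1 eval_succ)

lemma computable_code_const_term: "total_computable (\<lambda>n. code (const_term n))"
proof -
  have "code (const_term n) = rec_nat (code Zero)
      (\<lambda>_ u. prod_encode (3, prod_encode (code Succ, cons_code u 0))) n" for n
    by (induction n) auto
  moreover have "total_computable (\<lambda>n. rec_nat (code Zero)
      (\<lambda>_ u. prod_encode (3, prod_encode (code Succ, cons_code u 0))) n)"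
    by (intro computable)
  ultimately show ?thesis
    by simp
qed

lemma code_mem_jump_iff: "code t \<in> jump B \<longleftrightarrow> (\<exists>v. eval (real_oracle B) t [code t] v)"
  unfolding jump_def using code_inject by blast

lemma real_oracle_of_bool: "real_oracle B i = Some (of_bool (i \<in> B))"
  by (simp add: real_oracle_def)

text \<open>Uniform completeness of the jump: \<open>h q\<close> is an index of the unbounded search
  for \<open>c\<close>, with \<open>q\<close> built into the program. The relation sees the oracle
  only through the prefix of length \<open>c\<close>, so it can be decided on codes of finite
  sets.\<close>

lemma jump_code_of_search:
  assumes "decidable (\<lambda>z. R (pfst z) (pfst (psnd z)) (set_decode (psnd (psnd z))))"
  obtains h where "total_computable h" "\<And>q B. h q \<in> jump B \<longleftrightarrow> (\<exists>c. R q c (B \<inter> {..<c}))"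
proof -
  obtain r where r: "\<And>orc z. eval orc r [z] (of_bool (\<not> R (pfst z) (pfst (psnd z)) (set_decode (psnd (psnd z)))))"
    using computable_of_bool[OF decidable_not[OF assms]] unfolding total_computable_iff by blast
  obtain p where p: "\<And>orc x y. eval orc p [x, y] (prod_encode (x, y))"
    using binary_computable_pair unfolding binary_computable_def by blast
  obtain t where t: "\<And>orc B l. (\<forall>i<l. orc i = Some (of_bool (i \<in> B))) \<Longrightarrow>
      eval orc t [l] (set_encode (B \<inter> {..<l}))"
    using oracle_prefix_term by blast
  \<comment> \<open>\<open>m\<close> reads the oracle below \<open>c\<close> and returns
    \<open>0\<close> exactly if \<open>R\<close> holds.\<close>
  define m where "m = Comp r [Comp p [Proj 1, Comp p [Proj 0, Comp t [Proj 0]]]]"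
  have m: "eval (real_oracle B) m [c, q] (of_bool (\<not> R q c (B \<inter> {..<c})))" for B c q
  proof -
    have "eval (real_oracle B) (Comp p [Proj 1, Comp p [Proj 0, Comp t [Proj 0]]]) [c, q]
        (prod_encode (q, prod_encode (c, set_encode (B \<inter> {..<c}))))"
      by (intro eval_Comp2[OF _ _ p] eval_Comp1[OF _ t]) (auto intro: eval_Proj simp: real_oracle_of_bool)
    from eval_Comp1[OF this r] show ?thesis
      by (simp add: m_def)
  qed
  \<comment> \<open>\<open>const_term q\<close> overrides the input, so the run of this program on
    its own code is the search for \<open>q\<close>.\<close>
  define h where "h q = code (Comp (Mn m) [const_term q])" for q
  show thesis
  proof
    show "total_computable h"
      unfolding h_def by (simp, intro computable computable_code_const_term)
    fix q B
    have "h q \<in> jump B \<longleftrightarrow> (\<exists>v. eval (real_oracle B) (Mn m) [q] v)"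
      unfolding h_def code_mem_jump_iff by (intro ex_cong1 eval_Comp1_iff eval_const_term)
    also have "\<dots> \<longleftrightarrow> (\<exists>c. R q c (B \<inter> {..<c}))"
    proof
      assume "\<exists>v. eval (real_oracle B) (Mn m) [q] v"
      then obtain c where "eval (real_oracle B) m [c, q] 0"
        by (auto elim: eval_MnE)
      from eval_det[OF m this] show "\<exists>c. R q c (B \<inter> {..<c})"
        by auto
    next
      assume ex: "\<exists>c. R q c (B \<inter> {..<c})"
      define c where "c = (LEAST c. R q c (B \<inter> {..<c}))"
      have "R q c (B \<inter> {..<c})"
        unfolding c_def using ex by (rule LeastI_ex)
      then have "eval (real_oracle B) m [c, q] 0"
        using m[of B c q] by simp
      moreover have "\<exists>u. eval (real_oracle B) m [z, q] (Suc u)" if "z < c" for z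
        using m[of B z q] not_less_Least[of z "\<lambda>c. R q c (B \<inter> {..<c})"] that unfolding c_def by auto
      ultimately show "\<exists>v. eval (real_oracle B) (Mn m) [q] v"
        using eval_mn by blast
    qed
    finally show "h q \<in> jump B \<longleftrightarrow> (\<exists>c. R q c (B \<inter> {..<c}))" .
  qed
qed

primrec subst_oracle :: "recf \<Rightarrow> recf \<Rightarrow> recf" where
  "subst_oracle s Zero = Zero"
| "subst_oracle s Succ = Succ"
| "subst_oracle s (Proj i) = Proj i"
| "subst_oracle s (Comp f gs) = Comp (subst_oracle s f) (map (subst_oracle s) gs)"
| "subst_oracle s (Prim f g) = Prim (subst_oracle s f) (subst_oracle s g)"
| "subst_oracle s (Mn f) = Mn (subst_oracle s f)"
| "subst_oracle s Orc = s"

text \<open>\<open>Orc\<close> looks only at the head of its argument list, so \<open>s\<close> has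
  to return the answer for \<open>i\<close> on every list that starts with \<open>i\<close>.\<close>

lemma eval_subst_oracle:
  assumes "eval orc t xs v" "\<And>i u xs. orc i = Some u \<Longrightarrow> eval orc' s (i # xs) u"
  shows "eval orc' (subst_oracle s t) xs v"
  using assms
proof (induction rule: eval.induct)
  case (eval_comp ys gs orc xs f v)
  then show ?case
    by (auto intro!: eval.eval_comp[of ys])
next
  case (eval_mn orc f y xs)
  then show ?case
    unfolding subst_oracle.simps by (intro eval.eval_mn) blast+
qed (auto intro: eval.intros)

lemma string_oracle_take:
  "string_oracle (take n \<sigma>) i = Some u \<Longrightarrow> string_oracle \<sigma> i = Some u"
  by (auto simp: string_oracle_def split: if_splits)

lemma eval_string_oracle_take:
  "eval (string_oracle (take n \<sigma>)) t xs v \<Longrightarrow> eval (string_oracle \<sigma>) t xs v"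
  by (erule eval_mono) (rule string_oracle_take)

definition tt_bound :: "recf \<Rightarrow> (nat \<Rightarrow> nat) \<Rightarrow> bool" where
  "tt_bound \<Phi> f \<longleftrightarrow> (\<forall>n \<sigma>. f n \<le> length \<sigma> \<longrightarrow> (\<exists>v. eval (string_oracle \<sigma>) \<Phi> [n] v))"

text \<open>A longer string is cut to length \<open>f n\<close>, and the computation found there
  survives by \<open>eval_mono\<close>. With an inequality in place of the equation, bounds of
  several reductions can be added.\<close>

lemma tt_functional_iff: "tt_functional \<Phi> \<longleftrightarrow> (\<exists>f. total_computable f \<and> tt_bound \<Phi> f)"
  unfolding tt_functional_def tt_bound_def
proof (intro ex_cong1 conj_cong refl iffI allI impI)
  fix f n and \<sigma> :: "bool list"
  assume "\<forall>n \<sigma>. length \<sigma> = f n \<longrightarrow> (\<exists>v. eval (string_oracle \<sigma>) \<Phi> [n] v)" "f n \<le> length \<sigma>"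
  then obtain v where "eval (string_oracle (take (f n) \<sigma>)) \<Phi> [n] v"
    by (metis length_take min.absorb2)
  then show "\<exists>v. eval (string_oracle \<sigma>) \<Phi> [n] v"
    using eval_string_oracle_take by blast
qed auto

lemma tt_leI:
  "total_computable f \<Longrightarrow> tt_bound \<Phi> f \<Longrightarrow> computes_from \<Phi> B A \<Longrightarrow> tt_le A B"
  unfolding tt_le_def tt_functional_iff by blast

lemma tt_leE:
  assumes "tt_le A B"
  obtains \<Phi> f where "total_computable f" "tt_bound \<Phi> f" "computes_from \<Phi> B A"
  using assms unfolding tt_le_def tt_functional_iff by blast

lemma tt_le_trans:
  assumes "tt_le A B" "tt_le B C"
  shows "tt_le A C"
proof -
  obtain \<Phi> f where f: "total_computable f" "tt_bound \<Phi> f" "computes_from \<Phi> B A"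
    using assms(1) by (rule tt_leE)
  obtain \<Psi> g where g: "total_computable g" "tt_bound \<Psi> g" "computes_from \<Psi> C B"
    using assms(2) by (rule tt_leE)
  \<comment> \<open>On a string that is no prefix of \<open>C\<close> the functional
    \<open>\<Psi>\<close> may return any number; \<open>b\<close> turns it into a bit that can serve
    as an oracle answer.\<close>
  have "total_computable (\<lambda>x. of_bool (x \<noteq> 0))"
    by (intro computable)
  then obtain b where b: "\<And>orc x. eval orc b [x] (of_bool (x \<noteq> 0))"
    unfolding total_computable_iff by blast
  define s where "s = Comp b [Comp \<Psi> [Proj 0]]"
  have s: "eval orc s (i # xs) (of_bool (v \<noteq> 0))" if "eval orc \<Psi> [i] v" for orc i xs v
    unfolding s_def using that by (intro eval_Comp1[OF _ b] eval_Comp1[OF eval_Proj]) auto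
  show ?thesis
  proof (rule tt_leI)
    show "total_computable (\<lambda>n. \<Sum>i<f n. g i)"
      by (intro computable f computable_compose[OF g(1)])
    show "tt_bound (subst_oracle s \<Phi>) (\<lambda>n. \<Sum>i<f n. g i)"
      unfolding tt_bound_def
    proof (intro allI impI)
      fix n and \<sigma> :: "bool list"
      assume \<sigma>: "(\<Sum>i<f n. g i) \<le> length \<sigma>"
      have "\<exists>v. eval (string_oracle \<sigma>) \<Psi> [i] v" if "i < f n" for i
      proof -
        have "g i \<le> (\<Sum>i<f n. g i)"
          using that by (intro member_le_sum) auto
        then show ?thesis
          using g(2) \<sigma> unfolding tt_bound_def by (meson le_trans)
      qed
      then obtain w where w: "\<And>i. i < f n \<Longrightarrow> eval (string_oracle \<sigma>) \<Psi> [i] (w i)"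
        by metis
      \<comment> \<open>\<open>\<rho>\<close> is the string of length \<open>f n\<close> whose bits
        \<open>\<Psi>\<close> computes from \<open>\<sigma>\<close>; on it \<open>\<Phi>\<close>
        converges at \<open>n\<close>.\<close>
      define \<rho> where "\<rho> = map (\<lambda>i. w i \<noteq> 0) [0..<f n]"
      obtain v where "eval (string_oracle \<rho>) \<Phi> [n] v"
        using f(2) unfolding tt_bound_def \<rho>_def by (metis diff_zero le_refl length_map length_upt)
      moreover have "eval (string_oracle \<sigma>) s (i # xs) u" if "string_oracle \<rho> i = Some u" for i u xs
        using that s[OF w, of i xs] by (auto simp: string_oracle_def \<rho>_def of_bool_def split: if_splits)
      ultimately show "\<exists>v. eval (string_oracle \<sigma>) (subst_oracle s \<Phi>) [n] v"
        using eval_subst_oracle by blast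
    qed
    show "computes_from (subst_oracle s \<Phi>) C A"
      unfolding computes_from_def
    proof
      fix n
      have "eval (real_oracle C) s (i # xs) u" if "real_oracle B i = Some u" for i u xs
        using that s[of "real_oracle C" i _ xs] g(3)[unfolded computes_from_def, rule_format, of i]
        by (fastforce simp: real_oracle_def)
      then show "eval (real_oracle C) (subst_oracle s \<Phi>) [n] (if n \<in> A then 1 else 0)"
        using f(3) eval_subst_oracle unfolding computes_from_def by blast
    qed
  qed
qed

lemma tt_le_join:
  assumes "tt_le A C" "tt_le B C"
  shows "tt_le (join A B) C"
proof -
  obtain \<Phi> f where f: "total_computable f" "tt_bound \<Phi> f" "computes_from \<Phi> C A"
    using assms(1) by (rule tt_leE)
  obtain \<Psi> g where g: "total_computable g" "tt_bound \<Psi> g" "computes_from \<Psi> C B"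
    using assms(2) by (rule tt_leE)
  have "total_computable (\<lambda>z. if even (pfst z) then pfst (psnd z) else psnd (psnd z))"
    by (intro computable)
  then obtain b where b: "\<And>orc z. eval orc b [z] (if even (pfst z) then pfst (psnd z) else psnd (psnd z))"
    unfolding total_computable_iff by blast
  obtain p where p: "\<And>orc x y. eval orc p [x, y] (prod_encode (x, y))"
    using binary_computable_pair unfolding binary_computable_def by blast
  have "total_computable (\<lambda>n. n div 2)"
    by (intro computable)
  then obtain d where d: "\<And>orc n. eval orc d [n] (n div 2)"
    unfolding total_computable_iff by blast
  \<comment> \<open>Both reductions are run at \<open>n div 2\<close> and the parity of
    \<open>n\<close> selects afterwards, so the sum of the two bounds is a bound.\<close>
  define s where "s = Comp b [Comp p [Proj 0, Comp p [Comp \<Phi> [d], Comp \<Psi> [d]]]]"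
  have s: "eval orc s [n] (if even n then u else v)"
    if "eval orc \<Phi> [n div 2] u" "eval orc \<Psi> [n div 2] v" for orc n u v
  proof -
    have "eval orc (Comp p [Proj 0, Comp p [Comp \<Phi> [d], Comp \<Psi> [d]]]) [n]
        (prod_encode (n, prod_encode (u, v)))"
      using that by (intro eval_Comp2[OF _ _ p] eval_Comp1[OF d]) (auto intro: eval_Proj)
    from eval_Comp1[OF this b] show ?thesis
      by (auto simp: s_def)
  qed
  show ?thesis
  proof (rule tt_leI)
    show "total_computable (\<lambda>n. f (n div 2) + g (n div 2))"
      by (intro computable computable_compose[OF f(1)] computable_compose[OF g(1)])
    show "tt_bound s (\<lambda>n. f (n div 2) + g (n div 2))"
      using f(2) g(2) s unfolding tt_bound_def by (meson add_leD1 add_leD2)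
    show "computes_from s C (join A B)"
      unfolding computes_from_def
    proof
      fix n
      show "eval (real_oracle C) s [n] (if n \<in> join A B then 1 else 0)"
        using s[OF f(3)[unfolded computes_from_def, rule_format] g(3)[unfolded computes_from_def, rule_format], of n]
        by (simp add: mem_join split: if_splits)
    qed
  qed
qed

text \<open>A functional with values in the natural numbers, given by its computable restriction to
  coded finite oracles and a computable use \<open>u\<close>. Being free of programs, this form is
  easy to compose and iterate.\<close>

definition tt_computable :: "(nat set \<Rightarrow> nat \<Rightarrow> nat) \<Rightarrow> bool" where
  "tt_computable F \<longleftrightarrow> total_computable (\<lambda>z. F (set_decode (psnd z)) (pfst z)) \<and>
     (\<exists>u. total_computable u \<and> (\<forall>B x. F (B \<inter> {..<u x}) x = F B x))"

lemma tt_le_of_tt_computable: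
  assumes "tt_computable F" "\<And>n. n \<in> A \<longleftrightarrow> F B n \<noteq> 0"
  shows "tt_le A B"
proof -
  obtain u where u: "total_computable u" "\<And>B x. F (B \<inter> {..<u x}) x = F B x"
    using assms(1) unfolding tt_computable_def by blast
  have "total_computable (\<lambda>z. of_bool (F (set_decode (psnd z)) (pfst z) \<noteq> 0))"
    using assms(1) unfolding tt_computable_def by (intro computable) auto
  then obtain r where r: "\<And>orc z. eval orc r [z] (of_bool (F (set_decode (psnd z)) (pfst z) \<noteq> 0))"
    unfolding total_computable_iff by blast
  obtain p where p: "\<And>orc x y. eval orc p [x, y] (prod_encode (x, y))"
    using binary_computable_pair unfolding binary_computable_def by blast
  obtain t where t: "\<And>orc B l. (\<forall>i<l. orc i = Some (of_bool (i \<in> B))) \<Longrightarrow>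
      eval orc t [l] (set_encode (B \<inter> {..<l}))"
    using oracle_prefix_term by blast
  obtain w where w: "\<And>orc x. eval orc w [x] (u x)"
    using u(1) unfolding total_computable_iff by blast
  define s where "s = Comp r [Comp p [Proj 0, Comp t [w]]]"
  have s: "eval orc s [n] (of_bool (F B n \<noteq> 0))"
    if "\<forall>i<u n. orc i = Some (of_bool (i \<in> B))" for orc B n
  proof -
    have "eval orc (Comp p [Proj 0, Comp t [w]]) [n] (prod_encode (n, set_encode (B \<inter> {..<u n})))"
      using that by (intro eval_Comp2[OF _ _ p] eval_Comp1[OF w t]) (auto intro: eval_Proj)
    from eval_Comp1[OF this r] show ?thesis
      by (simp add: s_def u(2))
  qed
  show ?thesis
  proof (rule tt_leI[OF u(1)])
    show "tt_bound s u"
      unfolding tt_bound_def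
    proof (intro allI impI)
      fix n and \<sigma> :: "bool list"
      assume "u n \<le> length \<sigma>"
      \<comment> \<open>\<open>\<sigma> ! i\<close> is unspecified past the end of
        \<open>\<sigma>\<close>, but only the positions below \<open>u n\<close> matter.\<close>
      then have "eval (string_oracle \<sigma>) s [n] (of_bool (F {i. \<sigma> ! i} n \<noteq> 0))"
        by (intro s) (auto simp: string_oracle_def)
      then show "\<exists>v. eval (string_oracle \<sigma>) s [n] v"
        by blast
    qed
    show "computes_from s B A"
      unfolding computes_from_def
    proof
      fix n
      show "eval (real_oracle B) s [n] (if n \<in> A then 1 else 0)"
        using s[of n "real_oracle B" B] assms(2) by (simp add: real_oracle_of_bool of_bool_def)
    qed
  qed
qed

section \<open>The use of composed and iterated functionals\<close>

lemma set_encode_less: "S \<subseteq> {..<n} \<Longrightarrow> set_encode S < 2 ^ n"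
proof -
  assume "S \<subseteq> {..<n}"
  then have "set_encode S \<le> set_encode {..<n}"
    unfolding set_encode_def by (intro sum_mono2) auto
  also have "\<dots> < 2 ^ n"
    unfolding set_encode_def by (induction n) (auto simp: lessThan_Suc)
  finally show ?thesis .
qed

lemma use_mono:
  assumes "\<And>B. F (B \<inter> {..<u}) = F B" "u \<le> u'"
  shows "F (B \<inter> {..<u'}) = F (B :: nat set)"
proof -
  have "B \<inter> {..<u'} \<inter> {..<u} = B \<inter> {..<u}"
    using assms(2) by auto
  then show ?thesis
    using assms(1)[of B] assms(1)[of "B \<inter> {..<u'}"] by simp
qed

text \<open>The use of an inner functional bounds its possible values, as only finitely many oracle
  prefixes matter; the use of the outer functional is then summed over all of these.\<close>

lemma use_compose:
  assumes "\<And>B. F (B \<inter> {..<u}) = F B" "\<And>B y. G (B \<inter> {..<w y}) y = G B y"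
    "u' = u + (\<Sum>\<tau><2 ^ u. w (F (set_decode \<tau>)))"
  shows "G (B \<inter> {..<u'}) (F (B \<inter> {..<u'})) = G B (F (B :: nat set))"
proof -
  let ?\<tau> = "set_encode (B \<inter> {..<u})"
  have "F B = F (set_decode ?\<tau>)"
    using assms(1) by simp
  moreover have "w (F (set_decode ?\<tau>)) \<le> (\<Sum>\<tau><2 ^ u. w (F (set_decode \<tau>)))"
    by (intro member_le_sum[of ?\<tau> _ "\<lambda>\<tau>. w (F (set_decode \<tau>))"]) (auto intro: set_encode_less)
  ultimately have "w (F B) \<le> u'" "u \<le> u'"
    using assms(3) by simp_all
  then show ?thesis
    using use_mono[of F, OF assms(1)] use_mono[of "\<lambda>B. G B (F B')" "w (F B')" for B', OF assms(2)] by metis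
qed

lemma tt_computable_compose:
  assumes "tt_computable G" "tt_computable F"
  shows "tt_computable (\<lambda>B x. G B (F B x))"
proof -
  obtain u where u: "total_computable u" "\<And>B x. F (B \<inter> {..<u x}) x = F B x"
    using assms(2) unfolding tt_computable_def by blast
  obtain w where w: "total_computable w" "\<And>B x. G (B \<inter> {..<w x}) x = G B x"
    using assms(1) unfolding tt_computable_def by blast
  have F: "total_computable (\<lambda>z. F (set_decode (psnd z)) (pfst z))"
    and G: "total_computable (\<lambda>z. G (set_decode (psnd z)) (pfst z))"
    using assms unfolding tt_computable_def by auto
  have "total_computable (\<lambda>z. G (set_decode (psnd z)) (F (set_decode (psnd z)) (pfst z)))"
    using computable_compose[OF G computable_pair[OF F computable_psnd[OF computable_id]]] by simp
  moreover have "total_computable (\<lambda>x. u x + (\<Sum>\<tau><2 ^ u x. w (F (set_decode \<tau>) x)))"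
    by (intro computable computable_compose[OF w(1)] u F)
  ultimately show ?thesis
    unfolding tt_computable_def
    using use_compose[of "\<lambda>B. F B x" "u x" G w for x, OF u(2) w(2)] by blast
qed

lemma tt_computable_of_computable:
  assumes "total_computable f"
  shows "tt_computable (\<lambda>B. f)"
  unfolding tt_computable_def
  using computable_compose[OF assms computable_pfst[OF computable_id]] computable_const[of 0] by blast

lemma tt_computable_query: "tt_computable (\<lambda>B x. of_bool (x \<in> B))"
  unfolding tt_computable_def
  by (intro conjI computable exI[of _ Suc] allI computable_Suc0) simp

lemma tt_computable_pair:
  assumes "tt_computable F" "tt_computable G"
  shows "tt_computable (\<lambda>B x. prod_encode (F B x, G B x))"
proof -
  obtain u where u: "total_computable u" "\<And>B x. F (B \<inter> {..<u x}) x = F B x"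
    using assms(1) unfolding tt_computable_def by blast
  obtain w where w: "total_computable w" "\<And>B x. G (B \<inter> {..<w x}) x = G B x"
    using assms(2) unfolding tt_computable_def by blast
  have "total_computable (\<lambda>z. prod_encode (F (set_decode (psnd z)) (pfst z), G (set_decode (psnd z)) (pfst z)))"
    using assms unfolding tt_computable_def by (intro computable) auto
  moreover have "total_computable (\<lambda>x. u x + w x)"
    using u w by (intro computable)
  moreover have "F (B \<inter> {..<u x + w x}) x = F B x" "G (B \<inter> {..<u x + w x}) x = G B x" for B x
    using use_mono[of "\<lambda>B. F B x" "u x"] use_mono[of "\<lambda>B. G B x" "w x"] u w by auto
  ultimately show ?thesis
    unfolding tt_computable_def by (intro conjI exI[of _ "\<lambda>x. u x + w x"]) simp_all
qed

text \<open>The use of \<open>n\<close> steps is itself defined by recursion. Since the value after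
  \<open>n\<close> steps depends on the oracle, the use of the next step is summed over all prefixes
  that can matter. Applied to the stage construction, this lists the reachable conditions.\<close>

lemma tt_computable_rec:
  assumes "tt_computable (\<lambda>B z. h B (pfst z) (psnd z))"
  shows "tt_computable (\<lambda>B n. rec_nat c (h B) n)"
proof -
  let ?F = "\<lambda>B n. rec_nat c (h B) n"
  let ?G = "\<lambda>B z. h B (pfst z) (psnd z)"
  obtain w where w: "total_computable w" "\<And>B z. ?G (B \<inter> {..<w z}) z = ?G B z"
    using assms unfolding tt_computable_def by blast
  have G: "total_computable (\<lambda>z. ?G (set_decode (psnd z)) (pfst z))"
    using assms unfolding tt_computable_def by blast
  have "total_computable (\<lambda>z. h (set_decode (psnd (pfst z))) (pfst (psnd z)) (psnd (psnd z)))"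
    using computable_compose[OF G, of "\<lambda>z. prod_encode (psnd z, psnd (pfst z))"]
      computable_pair[OF computable_psnd[OF computable_id] computable_psnd[OF computable_pfst[OF computable_id]]]
    by simp
  then have F: "total_computable (\<lambda>z. ?F (set_decode (psnd z)) (pfst z))"
    by (intro computable)
  define u where "u = rec_nat 0 (\<lambda>n k. k + (\<Sum>\<tau><2 ^ k. w (prod_encode (n, ?F (set_decode \<tau>) n))))"
  have "total_computable (\<lambda>n. u n)"
    unfolding u_def by (intro computable computable_compose[OF w(1)] computable_compose[OF F, of "\<lambda>z. prod_encode (f z, g z)" for f g, simplified])
  moreover have "?F (B \<inter> {..<u n}) n = ?F B n" for B n
  proof (induction n arbitrary: B)
    case (Suc n)
    have "?G (B \<inter> {..<u (Suc n)}) (prod_encode (n, ?F (B \<inter> {..<u (Suc n)}) n)) = ?G B (prod_encode (n, ?F B n))"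
      by (rule use_compose[of "\<lambda>B. prod_encode (n, ?F B n)" "u n" ?G w])
        (use Suc w(2) in \<open>auto simp: u_def\<close>)
    then show ?case
      by simp
  qed simp
  ultimately show ?thesis
    using F unfolding tt_computable_def by blast
qed

subsection \<open>Covers of Cantor space and the stage construction\<close>

lemma tt_computable_app:
  "total_computable h \<Longrightarrow> tt_computable F \<Longrightarrow> tt_computable (\<lambda>B x. h (F B x))"
  using tt_computable_compose[OF tt_computable_of_computable] .

lemma tt_computable_app2:
  assumes "total_computable (\<lambda>z. h (pfst z) (psnd z))" "tt_computable F" "tt_computable G"
  shows "tt_computable (\<lambda>B x. h (F B x) (G B x))"
  using tt_computable_app[OF assms(1) tt_computable_pair[OF assms(2,3)]] by simp

text \<open>The query position \<open>K B x\<close> may itself depend on the oracle. Both branches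
  are computed before the answer selects one.\<close>

lemma tt_computable_if:
  assumes "tt_computable K" "tt_computable F" "tt_computable G"
  shows "tt_computable (\<lambda>B x. if K B x \<in> B then F B x else G B x)"
proof -
  have "total_computable (\<lambda>z. if pfst z \<noteq> 0 then pfst (psnd z) else psnd (psnd z))"
    by (intro computable)
  from tt_computable_app[OF this tt_computable_pair[OF
        tt_computable_compose[OF tt_computable_query assms(1)] tt_computable_pair[OF assms(2,3)]]]
  show ?thesis
    by (simp cong: if_cong)
qed

lemma tt_le_of_query:
  assumes "tt_computable K" "\<And>n. n \<in> A \<longleftrightarrow> K B n \<in> B"
  shows "tt_le A B"
  by (rule tt_le_of_tt_computable[OF tt_computable_compose[OF tt_computable_query assms(1)]])
    (simp add: assms(2))

lemma tt_le_of_m_reduction: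
  "total_computable h \<Longrightarrow> (\<And>n. n \<in> A \<longleftrightarrow> h n \<in> B) \<Longrightarrow> tt_le A B"
  by (rule tt_le_of_query[OF tt_computable_of_computable])

lemma tt_le_refl: "tt_le A A"
  by (rule tt_le_of_m_reduction[OF computable_id]) simp

text \<open>Compactness of Cantor space: without a uniform level, bad prefixes have bad extensions,
  and the infinite branch through them contradicts the level that \<open>bar\<close> gives for
  it.\<close>

lemma fan_theorem:
  assumes mono: "\<And>l l' G. P l G \<Longrightarrow> l \<le> l' \<Longrightarrow> P l' G"
    and local: "\<And>l G G'. P l G \<Longrightarrow> G \<inter> {..<l} = G' \<inter> {..<l} \<Longrightarrow> P l G'"
    and bar: "\<And>G :: nat set. \<exists>l. P l G"
  shows "\<exists>l. \<forall>G. P l G"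
proof (rule ccontr)
  assume "\<nexists>l. \<forall>G. P l G"
  \<comment> \<open>\<open>S\<close> is a prefix of length \<open>n\<close>, bad if no single level
    works for all reals extending it.\<close>
  define bad where "bad n S \<longleftrightarrow> (\<forall>l. \<exists>G. G \<inter> {..<n} = S \<and> \<not> P l G)" for n S
  \<comment> \<open>Levels that work for the two extensions by one bit have a maximum, which by
    monotonicity works for \<open>S\<close>.\<close>
  have split: "bad (Suc n) (insert n S)" if S: "bad n S" "\<not> bad (Suc n) S" for n S
  proof (rule ccontr)
    assume "\<not> bad (Suc n) (insert n S)"
    then obtain l' where l': "\<And>G. G \<inter> {..<Suc n} = insert n S \<Longrightarrow> P l' G"
      unfolding bad_def by meson
    obtain l where l: "\<And>G. G \<inter> {..<Suc n} = S \<Longrightarrow> P l G"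
      using S(2) unfolding bad_def by meson
    obtain G where G: "G \<inter> {..<n} = S" "\<not> P (max l l') G"
      using S(1) unfolding bad_def by meson
    have "G \<inter> {..<Suc n} = (if n \<in> G then insert n S else S)"
      using G(1) by (auto simp: lessThan_Suc)
    then have "P l G \<or> P l' G"
      using l l' by (auto split: if_splits)
    then show False
      using G(2) mono by (meson max.cobounded1 max.cobounded2)
  qed
  define S where "S = rec_nat {} (\<lambda>n S. if bad (Suc n) S then S else insert n S)"
  have S: "S 0 = {}" "S (Suc n) = (if bad (Suc n) (S n) then S n else insert n (S n))" for n
    by (simp_all add: S_def)
  have bad: "bad n (S n)" for n
  proof (induction n)
    case 0
    then show ?case
      using \<open>\<nexists>l. \<forall>G. P l G\<close> by (auto simp: bad_def S)
  next
    case (Suc n)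
    then show ?case
      using split by (simp add: S)
  qed
  define G where "G = {n. n \<in> S (Suc n)}"
  have "S n = G \<inter> {..<n}" for n
  proof (induction n)
    case (Suc n)
    then have "n \<notin> S n"
      by simp
    then have "S (Suc n) = (if n \<in> G then insert n (S n) else S n)"
      unfolding G_def S(2) by auto
    then show ?case
      using Suc by (auto simp: lessThan_Suc)
  qed (simp add: S)
  moreover obtain l where "P l G"
    using bar by blast
  moreover obtain G' where "G' \<inter> {..<l} = S l" "\<not> P l G'"
    using bad[of l] unfolding bad_def by meson
  ultimately show False
    using local[of l G G'] by simp
qed

section \<open>Bounded covers and compactness\<close>

lemma join_local:
  assumes "A \<inter> {..<l} = A' \<inter> {..<l}" "G \<inter> {..<l} = G' \<inter> {..<l}"
  shows "join A G \<inter> {..<l} = join A' G' \<inter> {..<l}"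
proof -
  have "n \<in> join A G \<longleftrightarrow> n \<in> join A' G'" if "n < l" for n
  proof -
    have "n div 2 < l"
      using that by linarith
    then show ?thesis
      unfolding mem_join using assms by auto
  qed
  then show ?thesis
    by auto
qed

text \<open>At level \<open>l\<close> the class of the condition \<open>F\<close> is already seen to
  be empty.\<close>

definition covered :: "nat \<Rightarrow> nat set \<Rightarrow> nat set \<Rightarrow> bool" where
  "covered l F A \<longleftrightarrow> (\<forall>G. \<exists>s\<in>F. halts_within l s (join A G))"

lemma covered_mono: "covered l F A \<Longrightarrow> l \<le> l' \<Longrightarrow> covered l' F A"
  unfolding covered_def using halts_within_mono by blast

lemma covered_local: "A \<inter> {..<l} = A' \<inter> {..<l} \<Longrightarrow> covered l F A \<longleftrightarrow> covered l F A'"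
  unfolding covered_def using join_local[of A l A', OF _ refl] halts_within_local by metis

text \<open>The fan theorem turns a halting bound for each \<open>G\<close> into one for all
  \<open>G\<close>. Thus emptiness of a class, a statement about all reals, becomes the existence of
  a level.\<close>

lemma covered_iff: "(\<exists>l. covered l F A) \<longleftrightarrow> (\<forall>G. F \<inter> jump (join A G) \<noteq> {})"
proof
  assume "\<forall>G. F \<inter> jump (join A G) \<noteq> {}"
  then have "\<exists>l. \<exists>s\<in>F. halts_within l s (join A G)" for G
    using jump_iff_halts_within by blast
  then show "\<exists>l. covered l F A"
    unfolding covered_def
  proof (rule fan_theorem[rotated 2])
    fix l l' G
    assume "\<exists>s\<in>F. halts_within l s (join A G)" "l \<le> l'"
    then show "\<exists>s\<in>F. halts_within l' s (join A G)"
      using halts_within_mono by blast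
  next
    fix l G G'
    assume "\<exists>s\<in>F. halts_within l s (join A G)" "G \<inter> {..<l} = G' \<inter> {..<l}"
    then show "\<exists>s\<in>F. halts_within l s (join A G')"
      using halts_within_local[OF _ join_local[OF refl]] by blast
  qed
next
  assume "\<exists>l. covered l F A"
  then show "\<forall>G. F \<inter> jump (join A G) \<noteq> {}"
    unfolding covered_def using jump_iff_halts_within by blast
qed

lemma halts_within_less: "halts_within l s B \<Longrightarrow> s < l"
  unfolding halts_within_def using mem_set_decode_less le_prod_encode_1
  by (meson le_less_trans less_trans)

text \<open>A decreasing sequence of nonempty compact classes has a common point. If the union of
  all \<open>F n\<close> were covered at level \<open>l\<close>, only codes below \<open>l\<close>
  would take part, and these finitely many lie in a single \<open>F N\<close>.\<close>

lemma avoid_chain: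
  assumes "\<And>n. F n \<subseteq> F (Suc n)" "\<And>n. \<exists>G. F n \<inter> jump (join A G) = {}"
  shows "\<exists>G. \<forall>n. F n \<inter> jump (join A G) = {}"
proof (rule ccontr)
  assume "\<nexists>G. \<forall>n. F n \<inter> jump (join A G) = {}"
  then have "\<exists>l. covered l (\<Union>n. F n) A"
    unfolding covered_iff by blast
  then obtain l where l: "covered l (\<Union>n. F n) A" ..
  define S where "S = (\<Union>n. F n) \<inter> {..<l}"
  have "finite S" "S \<subseteq> (\<Union>n. F n)"
    by (auto simp: S_def)
  then have "\<exists>N. S \<subseteq> F N"
  proof (induction S rule: finite_induct)
    case (insert s S)
    then obtain N m where "S \<subseteq> F N" "s \<in> F m"
      by auto
    moreover have "F N \<subseteq> F (max N m)" "F m \<subseteq> F (max N m)"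
      by (simp_all add: lift_Suc_mono_le[of F, OF assms(1)])
    ultimately have "insert s S \<subseteq> F (max N m)"
      by auto
    then show ?case ..
  qed simp
  then obtain N where N: "S \<subseteq> F N" ..
  have "covered l (F N) A"
    unfolding covered_def
  proof
    fix G
    obtain s where "s \<in> (\<Union>n. F n)" "halts_within l s (join A G)"
      using l unfolding covered_def by blast
    then show "\<exists>s\<in>F N. halts_within l s (join A G)"
      using N halts_within_less unfolding S_def by blast
  qed
  then show False
    using covered_iff[of "F N" A] assms(2)[of N] by blast
qed

lemma decidable_covered [computable]:
  assumes "total_computable l" "total_computable F" "computable_set A"
  shows "decidable (\<lambda>x. covered (l x) (set_decode (F x)) (A x))"
proof -
  \<comment> \<open>By locality the prefixes of length \<open>l\<close> represent all
    \<open>G\<close>, so \<open>2 ^ l\<close> finite sets suffice.\<close>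
  have "covered l F A \<longleftrightarrow> (\<forall>\<tau><2 ^ l. \<exists>s\<in>F. halts_within l s (join A (set_decode \<tau>)))" for l F A
  proof
    assume bounded: "\<forall>\<tau><2 ^ l. \<exists>s\<in>F. halts_within l s (join A (set_decode \<tau>))"
    show "covered l F A"
      unfolding covered_def
    proof
      fix G
      have "set_encode (G \<inter> {..<l}) < 2 ^ l"
        by (rule set_encode_less) auto
      then obtain s where "s \<in> F" "halts_within l s (join A (G \<inter> {..<l}))"
        using bounded by fastforce
      moreover have "join A (G \<inter> {..<l}) \<inter> {..<l} = join A G \<inter> {..<l}"
        by (rule join_local) auto
      ultimately show "\<exists>s\<in>F. halts_within l s (join A G)"
        using halts_within_local by blast
    qed
  qed (auto simp: covered_def)
  then show ?thesis
    by (simp only:) (intro computable assms assms(1,2)[THEN computable_compose] computable_set_compose[OF assms(3)])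
qed

text \<open>\<open>bit_code n b\<close> in a condition forces \<open>G\<close> to have bit
  \<open>b\<close> at \<open>n\<close>. \<open>diag_code\<close> forces the diagonal class: if the
  part with bit \<open>b\<close> at \<open>F\<close> is covered at a level where the other part is
  not, then \<open>G\<close> has bit \<open>b\<close> at \<open>F\<close>. \<open>cover_code\<close>
  turns emptiness into one query to \<open>jump A\<close>.\<close>

locale jump_inversion =
  fixes A X :: "nat set" and bit_code :: "nat \<Rightarrow> bool \<Rightarrow> nat" and diag_code :: nat and cover_code :: "nat \<Rightarrow> nat"
  assumes computable_bit_code: "total_computable (\<lambda>n. bit_code n b)"
    and bit_code: "bit_code n b \<in> jump (join A G) \<longleftrightarrow> (n \<in> G) \<noteq> b"
    and diag_code: "diag_code \<in> jump (join A G) \<longleftrightarrow> (\<exists>F l b. (F \<in> G) \<noteq> b \<and>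
      covered l (insert (bit_code F b) (set_decode F)) A \<and>
      \<not> covered l (insert (bit_code F (\<not> b)) (set_decode F)) A)"
    and computable_cover_code: "total_computable cover_code"
    and cover_code: "cover_code F \<in> jump A \<longleftrightarrow> (\<exists>l. covered l (set_decode F) A)"
begin

definition avoidable :: "nat set \<Rightarrow> bool" where
  "avoidable F \<longleftrightarrow> (\<exists>G. F \<inter> jump (join A G) = {})"

lemma cover_code_iff: "cover_code F \<in> jump A \<longleftrightarrow> \<not> avoidable (set_decode F)"
  unfolding cover_code covered_iff avoidable_def by blast

lemma avoidable_diag: "avoidable {diag_code}"
proof -
  let ?c = "\<lambda>F l b. covered l (insert (bit_code F b) (set_decode F)) A"
  \<comment> \<open>\<open>F\<close> is put into this set exactly if the part with bit
    \<open>True\<close> is covered strictly before the other one.\<close>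
  let ?G = "{F. \<exists>l. ?c F l True \<and> \<not> ?c F l False}"
  have "diag_code \<notin> jump (join A ?G)"
  proof
    assume "diag_code \<in> jump (join A ?G)"
    then obtain F l b where b: "(F \<in> ?G) \<noteq> b" "?c F l b" "\<not> ?c F l (\<not> b)"
      unfolding diag_code by blast
    show False
    proof (cases b)
      case True
      then show ?thesis
        using b by auto
    next
      case False
      \<comment> \<open>Each part would be covered at a level where the other is not, which
        monotonicity in the level excludes.\<close>
      then obtain l' where "?c F l' True" "\<not> ?c F l' False" "?c F l False" "\<not> ?c F l True"
        using b by auto
      then show ?thesis
        using covered_mono by (meson linear)
    qed
  qed
  then show ?thesis
    unfolding avoidable_def by blast
qed

text \<open>If the part with bit \<open>b\<close> were empty, any \<open>G\<close> in the class of
  \<open>F\<close> would have the other bit at \<open>F\<close> and keep the other part uncovered at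
  every level. Then \<open>diag_code\<close> would halt for \<open>G\<close>, although it belongs to
  the condition.\<close>

lemma avoidable_bit:
  assumes "avoidable (set_decode F)" "diag_code \<in> set_decode F"
  shows "avoidable (insert (bit_code F b) (set_decode F))"
proof (rule ccontr)
  assume no: "\<not> avoidable (insert (bit_code F b) (set_decode F))"
  then have "\<exists>l. covered l (insert (bit_code F b) (set_decode F)) A"
    unfolding covered_iff avoidable_def by simp
  then obtain l where l: "covered l (insert (bit_code F b) (set_decode F)) A" ..
  obtain G where G: "set_decode F \<inter> jump (join A G) = {}"
    using assms(1) unfolding avoidable_def by blast
  have "bit_code F b \<in> jump (join A G)"
    using no G unfolding avoidable_def by auto
  then have b: "(F \<in> G) \<noteq> b"
    by (simp add: bit_code)
  then have "bit_code F (\<not> b) \<notin> jump (join A G)"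
    by (simp add: bit_code)
  then have "insert (bit_code F (\<not> b)) (set_decode F) \<inter> jump (join A G) = {}"
    using G by simp
  then have "\<not> covered l (insert (bit_code F (\<not> b)) (set_decode F)) A"
    using covered_iff[of "insert (bit_code F (\<not> b)) (set_decode F)" A] by blast
  then have "diag_code \<in> jump (join A G)"
    unfolding diag_code using l b by blast
  then show False
    using G assms(2) by blast
qed

text \<open>Membership of \<open>n\<close> in a condition keeps \<open>n\<close> out of the jump of
  \<open>join A G\<close>, so \<open>n\<close> is added whenever the class stays nonempty.\<close>

definition decide :: "nat \<Rightarrow> nat \<Rightarrow> nat" where
  "decide n F = (if cover_code (ins n F) \<in> jump A then F else ins n F)"

primrec stage :: "nat \<Rightarrow> nat" where
  "stage 0 = ins diag_code 0"
| "stage (Suc n) = ins (bit_code (decide n (stage n)) (n \<in> X)) (decide n (stage n))"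

lemma stage_avoidable: "avoidable (set_decode (stage n)) \<and> diag_code \<in> set_decode (stage n)"
proof (induction n)
  case 0
  then show ?case
    using avoidable_diag by simp
next
  case (Suc n)
  then have "avoidable (set_decode (decide n (stage n)))" "diag_code \<in> set_decode (decide n (stage n))"
    unfolding decide_def cover_code_iff by auto
  then show ?case
    using avoidable_bit by simp
qed

lemma exists_generic: "\<exists>G. \<forall>n. set_decode (stage n) \<inter> jump (join A G) = {}"
proof (rule avoid_chain)
  show "set_decode (stage n) \<subseteq> set_decode (stage (Suc n))" for n
    by (auto simp: decide_def)
  show "\<exists>G. set_decode (stage n) \<inter> jump (join A G) = {}" for n
    using stage_avoidable[of n] unfolding avoidable_def by blast
qed

text \<open>If adding \<open>n\<close> empties the class of \<open>stage n\<close>, every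
  \<open>G\<close> in that class has \<open>n\<close> in the jump; otherwise \<open>n\<close> enters
  the next stage and is avoided.\<close>

lemma jump_generic:
  assumes "\<forall>n. set_decode (stage n) \<inter> jump (join A G) = {}"
  shows "n \<in> jump (join A G) \<longleftrightarrow> cover_code (ins n (stage n)) \<in> jump A"
proof (cases "cover_code (ins n (stage n)) \<in> jump A")
  case True
  then have "insert n (set_decode (stage n)) \<inter> jump (join A G) \<noteq> {}"
    unfolding cover_code_iff avoidable_def by auto
  then show ?thesis
    using True assms by blast
next
  case False
  then have "n \<in> set_decode (stage (Suc n))"
    by (simp add: decide_def)
  then show ?thesis
    using False assms by blast
qed

lemma decode_generic:
  assumes "\<forall>n. set_decode (stage n) \<inter> jump (join A G) = {}"
  shows "n \<in> X \<longleftrightarrow> decide n (stage n) \<in> G"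
proof -
  have "bit_code (decide n (stage n)) (n \<in> X) \<in> set_decode (stage (Suc n))"
    by simp
  then have "bit_code (decide n (stage n)) (n \<in> X) \<notin> jump (join A G)"
    using assms by blast
  then show ?thesis
    by (simp add: bit_code)
qed

text \<open>The oracle is meant to be a join with \<open>jump A\<close> on its odd half.\<close>

definition oracle_decide :: "nat set \<Rightarrow> nat \<Rightarrow> nat \<Rightarrow> nat" where
  "oracle_decide B n F = (if Suc (2 * cover_code (ins n F)) \<in> B then F else ins n F)"

text \<open>\<open>q\<close> gives the position where the oracle holds the next bit of
  \<open>X\<close>: directly for \<open>join X (jump A)\<close>, and through the bits coded into
  \<open>G\<close> for \<open>join (join A G) (jump A)\<close>.\<close>

definition oracle_stage :: "(nat \<Rightarrow> nat \<Rightarrow> nat) \<Rightarrow> nat set \<Rightarrow> nat \<Rightarrow> nat" where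
  "oracle_stage q B = rec_nat (ins diag_code 0) (\<lambda>n F.
     if q n (oracle_decide B n F) \<in> B
     then ins (bit_code (oracle_decide B n F) True) (oracle_decide B n F)
     else ins (bit_code (oracle_decide B n F) False) (oracle_decide B n F))"

lemma oracle_decide_join: "oracle_decide (join Z (jump A)) = decide"
  by (simp add: fun_eq_iff oracle_decide_def decide_def)

lemma oracle_stage_join:
  assumes "\<And>n. q n (decide n (stage n)) \<in> join Z (jump A) \<longleftrightarrow> n \<in> X"
  shows "oracle_stage q (join Z (jump A)) n = stage n"
  by (induction n) (simp_all add: oracle_stage_def oracle_decide_join assms)

lemma tt_computable_oracle_decide:
  assumes "tt_computable N" "tt_computable F"
  shows "tt_computable (\<lambda>B x. oracle_decide B (N B x) (F B x))"
proof -
  have "total_computable (\<lambda>z. Suc (2 * cover_code (ins (pfst z) (psnd z))))"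
    "total_computable (\<lambda>z. ins (pfst z) (psnd z))"
    by (intro computable computable_compose[OF computable_cover_code])+
  then show ?thesis
    unfolding oracle_decide_def
    by (intro tt_computable_if assms tt_computable_app2[where h = "\<lambda>n F. Suc (2 * cover_code (ins n F))"]
        tt_computable_app2[where h = ins])
qed

lemma tt_computable_oracle_stage:
  assumes "total_computable (\<lambda>z. q (pfst z) (psnd z))"
  shows "tt_computable (oracle_stage q)"
proof -
  have bit: "total_computable (\<lambda>F. ins (bit_code F b) F)" for b
    by (intro computable computable_bit_code)
  have n: "tt_computable (\<lambda>B z. pfst z)" and F: "tt_computable (\<lambda>B z. psnd z)"
    by (intro tt_computable_of_computable computable)+
  note D = tt_computable_oracle_decide[OF n F]
  show ?thesis
    unfolding oracle_stage_def
    by (intro tt_computable_rec tt_computable_if tt_computable_app2[OF assms n D]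
        tt_computable_app[OF bit D])
qed

text \<open>The oracle supplies \<open>X\<close> and \<open>jump A\<close>, so the stages can be
  replayed, and the cover query of stage \<open>n\<close> settles \<open>n\<close>.\<close>

lemma jump_tt_le:
  assumes "\<forall>n. set_decode (stage n) \<inter> jump (join A G) = {}"
  shows "tt_le (jump (join A G)) (join X (jump A))"
proof (rule tt_le_of_query)
  have "tt_computable (oracle_stage (\<lambda>n F. 2 * n))"
    by (intro tt_computable_oracle_stage computable)
  then show "tt_computable (\<lambda>B n. Suc (2 * cover_code (ins n (oracle_stage (\<lambda>n F. 2 * n) B n))))"
    by (intro tt_computable_app2[where h = "\<lambda>n F. Suc (2 * cover_code (ins n F))"]
        tt_computable_of_computable computable computable_compose[OF computable_cover_code])
  show "n \<in> jump (join A G) \<longleftrightarrow>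
      Suc (2 * cover_code (ins n (oracle_stage (\<lambda>n F. 2 * n) (join X (jump A)) n))) \<in> join X (jump A)" for n
    using jump_generic[OF assms] by (simp add: oracle_stage_join)
qed

text \<open>\<open>stage n\<close> involves only bits of \<open>X\<close> below \<open>n\<close>,
  each of which is read from \<open>G\<close> at its own stage, while \<open>jump A\<close> answers
  the cover queries.\<close>

lemma tt_le_join_jump:
  assumes "\<forall>n. set_decode (stage n) \<inter> jump (join A G) = {}"
  shows "tt_le X (join (join A G) (jump A))"
proof (rule tt_le_of_query)
  \<comment> \<open>Bit \<open>F\<close> of \<open>G\<close> is bit \<open>Suc (2 * F)\<close> of
    \<open>join A G\<close>, which forms the even half of the oracle.\<close>
  let ?q = "\<lambda>n F. 2 * Suc (2 * F)"
  have q: "total_computable (\<lambda>z. 2 * Suc (2 * psnd z))"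
    by (intro computable)
  then have "tt_computable (oracle_stage ?q)"
    by (rule tt_computable_oracle_stage)
  then show "tt_computable (\<lambda>B n. 2 * Suc (2 * oracle_decide B n (oracle_stage ?q B n)))"
    by (intro tt_computable_app[where h = "\<lambda>F. 2 * Suc (2 * F)"] tt_computable_oracle_decide
        tt_computable_of_computable computable)
  have q_mem: "?q n (decide n (stage n)) \<in> join (join A G) (jump A) \<longleftrightarrow> n \<in> X" for n
    using decode_generic[OF assms] by (simp only: double_mem_join)
  show "n \<in> X \<longleftrightarrow> 2 * Suc (2 * oracle_decide (join (join A G) (jump A)) n
      (oracle_stage ?q (join (join A G) (jump A)) n)) \<in> join (join A G) (jump A)" for n
    unfolding oracle_stage_join[of ?q, OF q_mem] oracle_decide_join using q_mem by simp
qed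

end

section \<open>Existence of the codes that the construction assumes\<close>

lemma exists_bit_code:
  obtains h where "\<And>b. total_computable (\<lambda>n. h n b)"
    "\<And>n b A G. h n b \<in> jump (join A G) \<longleftrightarrow> (n \<in> G) \<noteq> b"
proof -
  \<comment> \<open>With \<open>n\<close> as \<open>pfst q\<close> and \<open>b\<close> as
    \<open>psnd q\<close>, the search succeeds once the prefix includes the bit of \<open>G\<close>
    at \<open>n\<close> and this bit differs from \<open>b\<close>.\<close>
  define R where "R q c B \<longleftrightarrow> Suc (2 * pfst q) < c \<and> (Suc (2 * pfst q) \<in> B) = (psnd q = 0)"
    for q c and B :: "nat set"
  have "decidable (\<lambda>z. R (pfst z) (pfst (psnd z)) (set_decode (psnd (psnd z))))"
    unfolding R_def by (intro computable)
  then obtain h where h: "total_computable h" "\<And>q B. h q \<in> jump B \<longleftrightarrow> (\<exists>c. R q c (B \<inter> {..<c}))"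
    by (rule jump_code_of_search) blast
  show thesis
  proof
    show "total_computable (\<lambda>n. h (prod_encode (n, of_bool b)))" for b
      by (intro computable_compose[OF h(1)] computable)
    show "h (prod_encode (n, of_bool b)) \<in> jump (join A G) \<longleftrightarrow> (n \<in> G) \<noteq> b" for n b A G
      unfolding h(2) R_def by (auto intro: exI[of _ "Suc (Suc (2 * n))"])
  qed
qed

text \<open>A cover at level \<open>l\<close> depends only on \<open>A\<close> below
  \<open>l\<close>, so it is a search that sees a prefix of length \<open>l\<close>.\<close>

lemma exists_cover_code:
  obtains h where "total_computable h"
    "\<And>F A. h F \<in> jump A \<longleftrightarrow> (\<exists>l. covered l (set_decode F) A)"
proof -
  have "decidable (\<lambda>z. covered (pfst (psnd z)) (set_decode (pfst z)) (set_decode (psnd (psnd z))))"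
    by (intro computable)
  from jump_code_of_search[of "\<lambda>F l B. covered l (set_decode F) B", OF this]
  obtain h where h: "total_computable h"
    "\<And>F A. h F \<in> jump A \<longleftrightarrow> (\<exists>l. covered l (set_decode F) (A \<inter> {..<l}))"
    by blast
  moreover have "covered l F (A \<inter> {..<l}) \<longleftrightarrow> covered l F A" for l F A
    by (rule covered_local) auto
  ultimately show thesis
    using that by simp
qed

lemma exists_diag_code:
  assumes "\<And>b. total_computable (\<lambda>n. h n b)"
  obtains d where "\<And>A G. d \<in> jump (join A G) \<longleftrightarrow> (\<exists>F l b. (F \<in> G) \<noteq> b \<and>
      covered l (insert (h F b) (set_decode F)) A \<and> \<not> covered l (insert (h F (\<not> b)) (set_decode F)) A)"
proof -
  \<comment> \<open>The even half of \<open>B\<close> stands for \<open>A\<close>, the odd half for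
    \<open>G\<close>.\<close>
  define P where "P F l b B \<longleftrightarrow> (Suc (2 * F) \<in> B) \<noteq> b \<and>
      covered l (set_decode (ins (h F b) F)) {n. 2 * n \<in> B} \<and>
      \<not> covered l (set_decode (ins (h F (\<not> b)) F)) {n. 2 * n \<in> B}" for F l b and B :: "nat set"
  \<comment> \<open>\<open>c\<close> exceeds \<open>Suc (2 * F)\<close> and \<open>2 * l\<close>, so
    the prefix of length \<open>c\<close> determines the bit of \<open>G\<close> at \<open>F\<close>
    and \<open>A\<close> below \<open>l\<close>. The two values of \<open>b\<close> are written out
    as a disjunction.\<close>
  define R where "R q c B \<longleftrightarrow> (\<exists>F<c. \<exists>l<c. Suc (2 * F) < c \<and> 2 * l < c \<and> (P F l True B \<or> P F l False B))"
    for q c :: nat and B :: "nat set"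
  have "decidable (\<lambda>z. R (pfst z) (pfst (psnd z)) (set_decode (psnd (psnd z))))"
    unfolding R_def P_def by (intro computable computable_compose[OF assms])
  then obtain d where d: "\<And>q B. d q \<in> jump B \<longleftrightarrow> (\<exists>c. R q c (B \<inter> {..<c}))"
    by (rule jump_code_of_search) blast
  have P_iff: "P F l b (join A G \<inter> {..<c}) \<longleftrightarrow> (F \<in> G) \<noteq> b \<and>
      covered l (insert (h F b) (set_decode F)) A \<and> \<not> covered l (insert (h F (\<not> b)) (set_decode F)) A"
    if "Suc (2 * F) < c" "2 * l < c" for F l b A G c
  proof -
    have "{n. 2 * n \<in> join A G \<inter> {..<c}} \<inter> {..<l} = A \<inter> {..<l}"
      using that(2) by auto
    from covered_local[OF this] show ?thesis
      using that(1) by (simp add: P_def)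
  qed
  show thesis
  proof
    fix A G
    let ?Q = "\<lambda>F l b. (F \<in> G) \<noteq> b \<and> covered l (insert (h F b) (set_decode F)) A \<and>
      \<not> covered l (insert (h F (\<not> b)) (set_decode F)) A"
    show "d 0 \<in> jump (join A G) \<longleftrightarrow> (\<exists>F l b. ?Q F l b)"
    proof
      assume "d 0 \<in> jump (join A G)"
      then obtain c F l b where c: "Suc (2 * F) < c" "2 * l < c" and P: "P F l b (join A G \<inter> {..<c})"
        unfolding d R_def by blast
      have "?Q F l b"
        using P unfolding P_iff[OF c] .
      then show "\<exists>F l b. ?Q F l b"
        by (intro exI)
    next
      assume "\<exists>F l b. ?Q F l b"
      then obtain F l b where Q: "?Q F l b"
        by (elim exE)
      let ?c = "Suc (Suc (2 * F)) + Suc (2 * l)"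
      have "P F l b (join A G \<inter> {..<?c})"
        by (subst P_iff) (use Q in auto)
      then have "P F l True (join A G \<inter> {..<?c}) \<or> P F l False (join A G \<inter> {..<?c})"
        by (cases b) auto
      then have "R 0 ?c (join A G \<inter> {..<?c})"
        unfolding R_def by (intro exI[of _ F] exI[of _ l] conjI) auto
      then show "d 0 \<in> jump (join A G)"
        unfolding d by blast
    qed
  qed
qed

text \<open>Searching for a prefix of \<open>A\<close> that contains \<open>n\<close> halts exactly
  if \<open>n\<close> is in \<open>A\<close>.\<close>

lemma tt_le_jump: "tt_le A (jump A)"
proof -
  have "decidable (\<lambda>z. pfst z \<in> set_decode (psnd (psnd z)))"
    by (intro computable)
  from jump_code_of_search[of "\<lambda>n c B. n \<in> B", OF this]
  obtain h where "total_computable h" "\<And>n B. h n \<in> jump B \<longleftrightarrow> (\<exists>c. n \<in> B \<inter> {..<c})"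
    by blast
  then show ?thesis
    by (intro tt_le_of_m_reduction) (auto intro: lessI)
qed

text \<open>Halting relative to \<open>A\<close> is searched for through the even half of
  \<open>join A G\<close>; the condition \<open>2 * l < c\<close> lets the prefix show
  \<open>A\<close> below \<open>l\<close>.\<close>

lemma jump_tt_le_jump_join: "tt_le (jump A) (jump (join A G))"
proof -
  define R where "R e c B \<longleftrightarrow> (\<exists>l<c. 2 * l < c \<and> halts_within l e {n. 2 * n \<in> B})"
    for e c and B :: "nat set"
  have "decidable (\<lambda>z. R (pfst z) (pfst (psnd z)) (set_decode (psnd (psnd z))))"
    unfolding R_def by (intro computable)
  then obtain h where h: "total_computable h" "\<And>q B. h q \<in> jump B \<longleftrightarrow> (\<exists>c. R q c (B \<inter> {..<c}))"
    by (rule jump_code_of_search) blast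
  have local: "halts_within l e {n. 2 * n \<in> join A G \<inter> {..<c}} \<longleftrightarrow> halts_within l e A" if "2 * l < c" for l e c
  proof -
    have "{n. 2 * n \<in> join A G \<inter> {..<c}} \<inter> {..<l} = A \<inter> {..<l}"
      using that by auto
    then show ?thesis
      using halts_within_local by metis
  qed
  have "e \<in> jump A \<longleftrightarrow> h e \<in> jump (join A G)" for e
  proof
    assume "e \<in> jump A"
    then obtain l where "halts_within l e A"
      unfolding jump_iff_halts_within by blast
    then have "R e (Suc (2 * l)) (join A G \<inter> {..<Suc (2 * l)})"
      unfolding R_def using local[of l "Suc (2 * l)" e] by (intro exI[of _ l]) auto
    then show "h e \<in> jump (join A G)"
      unfolding h(2) by blast
  next
    assume "h e \<in> jump (join A G)"
    then obtain c l where "2 * l < c" "halts_within l e {n. 2 * n \<in> join A G \<inter> {..<c}}"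
      unfolding h(2) R_def by blast
    then show "e \<in> jump A"
      unfolding jump_iff_halts_within using local by blast
  qed
  then show ?thesis
    by (rule tt_le_of_m_reduction[OF h(1)])
qed

theorem mainTheorem3:
  fixes A X :: "nat set"
  assumes "tt_le (jump A) X"
  shows "\<exists>Y. tt_le A Y \<and> tt_eq X (jump Y) \<and> tt_eq (jump Y) (join Y (jump A))"
proof -
  obtain h where h: "\<And>b. total_computable (\<lambda>n. h n b)"
    "\<And>n b A G. h n b \<in> jump (join A G) \<longleftrightarrow> (n \<in> G) \<noteq> b"
    by (rule exists_bit_code) (rule that)
  obtain d where d: "\<And>A G. d \<in> jump (join A G) \<longleftrightarrow> (\<exists>F l b. (F \<in> G) \<noteq> b \<and>
      covered l (insert (h F b) (set_decode F)) A \<and> \<not> covered l (insert (h F (\<not> b)) (set_decode F)) A)"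
    by (rule exists_diag_code[OF h(1)]) (rule that)
  obtain k where k: "total_computable k" "\<And>F A. k F \<in> jump A \<longleftrightarrow> (\<exists>l. covered l (set_decode F) A)"
    by (rule exists_cover_code) (rule that)
  interpret jump_inversion A X h d k
    by unfold_locales (rule h d k)+
  obtain G where G: "\<forall>n. set_decode (stage n) \<inter> jump (join A G) = {}"
    using exists_generic by blast
  define Y where "Y = join A G"
  have "tt_le A Y"
    unfolding Y_def by (rule tt_le_of_m_reduction[of "\<lambda>n. 2 * n"]) (intro computable, simp)
  moreover have "tt_le (jump Y) X"
    using jump_tt_le[OF G] tt_le_join[OF tt_le_refl assms] tt_le_trans unfolding Y_def by blast
  moreover have "tt_le X (join Y (jump A))"
    unfolding Y_def by (rule tt_le_join_jump[OF G])
  moreover have "tt_le (join Y (jump A)) (jump Y)"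
    unfolding Y_def by (intro tt_le_join tt_le_jump jump_tt_le_jump_join)
  \<comment> \<open>The reductions of \<open>X\<close> to \<open>join Y (jump A)\<close>, of that to
    \<open>jump Y\<close>, and of \<open>jump Y\<close> to \<open>X\<close> form a cycle, so all
    three are equivalent.\<close>
  ultimately show ?thesis
    unfolding tt_eq_def by (meson tt_le_trans)
qed

end
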